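(* Let $\rho$ be a probability distribution on $\mathcal S$, let $\pi^*$ be an optimal robust policy, and let $$M=\sup_{u\in\mathcal U}\Big\|\frac{d_\rho^{\pi^*,u}}{\rho}\Big\|_\infty,\qquad M'=\sup_{u,u'\in\mathcal U}\Big\|\frac{d_\rho^{\pi^*,u}}{d_\rho^{\pi^*,u'}}\Big\|_\infty ,$$ both of which are finite whenever $\mathrm{supp}(\rho)=\mathcal S$; assume $M,M'<\infty$. Let $(\pi_k)_{k\ge0}$ be generated by the robust policy mirror descent (RPMD) method with positive stepsizes satisfying $$\eta_k\ \ge\ \eta_{k-1}\Big(1-\frac{1-\gamma}{M}\Big)^{-1}M'\qquad\text{for all }k\ge1 .$$ Then for any iteration $k$, $$f_\rho(\pi_k)-f_\rho(\pi^* )\ \le\ \Big(1-\frac{1-\gamma}{M}\Big)^{k}\big(f_\rho(\pi_0)-f_\rho(\pi^* )\big)+\Big(1-\frac{1-\gamma}{M}\Big)^{k-1}\frac{D_w}{M\eta_0}.$$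
   Context: Robust MDP. $\mathcal S,\mathcal A$ are finite nonempty state and action sets, $c:\mathcal S\times\mathcal A\to\mathbb R$ is a cost with $0<c(s,a)\le1$, $\gamma\in(0,1)$ is the discount factor, and $\mathbb P_{N}$ is a nominal transition kernel ($\mathbb P_N(\cdot|s,a)\in\Delta_{\mathcal S}$, where $\Delta_{\mathcal X}$ is the probability simplex over $\mathcal X$). The uncertainty set $\mathcal U\subset\mathbb R^{|\mathcal S|\times|\mathcal S|\times|\mathcal A|}$ is nonempty, compact and $(s,a)$-rectangular: $\mathcal U=\prod_{s,a}\mathcal U_{s,a}$ with $\mathcal U_{s,a}=\{u(\cdot|s,a):u\in\mathcal U\}$; for every $u\in\mathcal U$, $\mathbb P_u(\cdot|s,a)=\mathbb P_N(\cdot|s,a)+u(\cdot|s,a)$ is a transition kernel. $\Pi$ is the set of stationary randomized policies ($\pi(\cdot|s)\in\Delta_{\mathcal A}$ for all $s$). Values. $V^\pi_u(s)=\mathbb E[\sum_{t\ge0}\gamma^t c(s_t,a_t)\mid s_0=s]$ with $a_t\sim\pi(\cdot|s_t)$, $s_{t+1}\sim\mathbb P_u(\cdot|s_t,a_t)$; $Q^\pi_u(s,a)$ is the same with in addition $a_0=a$. Robust values: $V^\pi_r(s)=\max_{u\in\mathcal U}V^\pi_u(s)$, $Q^\pi_r(s,a)=\max_{u\in\mathcal U}Q^\pi_u(s,a)$. Objective: $f_\rho(\pi)=\mathbb E_{s\sim\rho}[V^\pi_r(s)]$. An optimal robust policy $\pi^*$ satisfies $V^{\pi^*}_r(s)\le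 V^\pi_r(s)$ for all $s\in\mathcal S$, $\pi\in\Pi$ (such a policy exists). Visitation measures: $d^{\pi,u}_s(s')=(1-\gamma)\sum_{t\ge0}\gamma^t\Pr(s_t=s'\mid s_0=s)$ under policy $\pi$ and kernel $\mathbb P_u$; $d^{\pi,u}_\rho(s')=\mathbb E_{s\sim\rho}d^{\pi,u}_s(s')$. Ratios of measures are taken entrywise. RPMD. Let $w:\mathbb R^{|\mathcal A|}\to\mathbb R$ be strictly convex and $D^{\pi}_{\pi'}(s)=w(\pi(\cdot|s))-w(\pi'(\cdot|s))-\langle\partial w(\pi'(\cdot|s)),\pi(\cdot|s)-\pi'(\cdot|s)\rangle$ the Bregman divergence, where $\partial w(p)$ denotes a subgradient of $w$ at $p$ (when $w$ is not differentiable, the subgradient used at an iterate $\pi_{k+1}(\cdot|s)$ is one for which the first-order optimality condition of the update below holds). Given $\pi_0\in\Pi$ and stepsizes $\eta_k>0$, RPMD sets, for every $s\in\mathcal S$, $$\pi_{k+1}(\cdot|s)=\operatorname{argmin}_{p(\cdot|s)\in\Delta_{\mathcal A}}\ \eta_k\langle Q^{\pi_k}_r(s,\cdot),p(\cdot|s)\rangle+D^{p}_{\pi_k}(s).$$ $D_w=\max_{\pi\in\Pi}\max_{s\in\mathcal S}D^\pi_{\pi_0}(s)$, assumed finite. *)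

theory Defs
  imports "HOL-Probability.Probability"
begin

section \<open>Probability vectors and transition kernels\<close>

definition prob_simplex :: "(real ^ 'n::finite) set" where
  "prob_simplex = {p. (\<forall>i. 0 \<le> p $ i) \<and> (\<Sum>i\<in>UNIV. p $ i) = 1}"

definition vec_pmf :: "real ^ 'n::finite \<Rightarrow> 'n pmf" where
  "vec_pmf p = embed_pmf (\<lambda>i. p $ i)"

lemma pmf_vec_pmf:
  assumes "p \<in> prob_simplex"
  shows "pmf (vec_pmf p) i = p $ i"
proof -
  have "(\<integral>\<^sup>+ x. ennreal (p $ x) \<partial>count_space UNIV) = (\<Sum>x\<in>UNIV. ennreal (p $ x))"
    by (simp add: nn_integral_count_space_finite)
  also have "\<dots> = ennreal (\<Sum>x\<in>UNIV. p $ x)"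
    using assms by (intro sum_ennreal) (auto simp: prob_simplex_def)
  finally have "(\<integral>\<^sup>+ x. ennreal (p $ x) \<partial>count_space UNIV) = 1"
    using assms by (simp add: prob_simplex_def)
  then show ?thesis
    using assms unfolding vec_pmf_def prob_simplex_def by (intro pmf_embed_pmf) auto
qed

text \<open>A kernel \<open>P\<close> has \<open>P $ s $ a $ s'\<close> as the probability of moving from \<open>s\<close> to \<open>s'\<close> under
  action \<open>a\<close>; a policy \<open>\<pi>\<close> has \<open>\<pi> $ s $ a\<close> as the probability of choosing \<open>a\<close> in state \<open>s\<close>.\<close>

definition kernels :: "(real ^ 's::finite ^ 'a::finite ^ 's) set" where
  "kernels = {P. \<forall>s a. P $ s $ a \<in> prob_simplex}"

definition policies :: "(real ^ 'a::finite ^ 's::finite) set" where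
  "policies = {\<pi>. \<forall>s. \<pi> $ s \<in> prob_simplex}"


section \<open>Robust MDPs\<close>

locale robust_mdp =
  fixes c :: "'s::finite \<Rightarrow> 'a::finite \<Rightarrow> real"
    and \<gamma> :: real
    and PN :: "real ^ 's ^ 'a ^ 's"
    and U :: "(real ^ 's ^ 'a ^ 's) set"
  assumes cost_pos: "0 < c s a"
    and cost_le_1: "c s a \<le> 1"
    and discount: "0 < \<gamma>" "\<gamma> < 1"
    and nominal: "PN \<in> kernels"
    and U_nonempty: "U \<noteq> {}"
    and U_compact: "compact U"
    and U_rectangular: "U = {u. \<forall>s a. u $ s $ a \<in> (\<lambda>v. v $ s $ a) ` U}"
    and U_kernels: "u \<in> U \<Longrightarrow> PN + u \<in> kernels"


section \<open>Trajectories\<close>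

definition step_pmf ::
    "real ^ 's::finite ^ 'a::finite ^ 's \<Rightarrow> real ^ 'a ^ 's \<Rightarrow> 's \<times> 'a \<Rightarrow> ('s \<times> 'a) pmf" where
  "step_pmf P \<pi> = (\<lambda>(s, a).
     bind_pmf (vec_pmf (P $ s $ a)) (\<lambda>s'. map_pmf (Pair s') (vec_pmf (\<pi> $ s'))))"

definition traj_kernel ::
    "real ^ 's::finite ^ 'a::finite ^ 's \<Rightarrow> real ^ 'a ^ 's \<Rightarrow> ('s \<times> 'a) pmf \<Rightarrow>
     nat \<Rightarrow> (nat \<Rightarrow> 's \<times> 'a) \<Rightarrow> ('s \<times> 'a) measure" where
  "traj_kernel P \<pi> \<mu> t \<omega> =
     measure_pmf (case t of 0 \<Rightarrow> \<mu> | Suc t' \<Rightarrow> step_pmf P \<pi> (\<omega> t'))"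

lemma Ionescu_Tulcea_traj_kernel:
  fixes P :: "real ^ 's::finite ^ 'a::finite ^ 's"
  shows "Ionescu_Tulcea (traj_kernel P \<pi> \<mu>) (\<lambda>_. count_space UNIV)"
proof (rule Ionescu_Tulcea.intro)
  fix t :: nat
  show "traj_kernel P \<pi> \<mu> t
    \<in> PiM {0..<t} (\<lambda>_. count_space UNIV) \<rightarrow>\<^sub>M subprob_algebra (count_space UNIV)"
  proof (cases t)
    case 0
    then show ?thesis
      by (auto simp: traj_kernel_def[abs_def] intro!: measurable_const measure_pmf_in_subprob_algebra)
  next
    case (Suc t')
    have "(\<lambda>\<omega>. \<omega> t') \<in> PiM {0..<t} (\<lambda>_. count_space UNIV) \<rightarrow>\<^sub>M count_space UNIV"
      by (rule measurable_component_singleton) (simp add: Suc)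
    moreover have "(\<lambda>x. measure_pmf (step_pmf P \<pi> x))
        \<in> count_space UNIV \<rightarrow>\<^sub>M subprob_algebra (count_space UNIV)"
      by (auto intro!: measure_pmf_in_subprob_algebra)
    ultimately show ?thesis
      unfolding traj_kernel_def[abs_def] Suc by (simp add: measurable_compose)
  qed
next
  fix t and \<omega> :: "nat \<Rightarrow> 's \<times> 'a"
  show "prob_space (traj_kernel P \<pi> \<mu> t \<omega>)"
    by (simp add: traj_kernel_def measure_pmf.prob_space_axioms)
qed

text \<open>The law of \<open>(s\<^sub>t, a\<^sub>t)\<^sub>t\<close> when \<open>(s\<^sub>0, a\<^sub>0)\<close> has law \<open>\<mu>\<close>, as the Ionescu-Tulcea extension of the
  one-step kernels.\<close>

definition trajectory ::
    "real ^ 's::finite ^ 'a::finite ^ 's \<Rightarrow> real ^ 'a ^ 's \<Rightarrow> ('s \<times> 'a) pmf \<Rightarrow>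
     (nat \<Rightarrow> 's \<times> 'a) measure" where
  "trajectory P \<pi> \<mu> =
     projective_family.lim UNIV
       (Ionescu_Tulcea.CI (traj_kernel P \<pi> \<mu>) (\<lambda>_. count_space UNIV)) (\<lambda>_. count_space UNIV)"

definition trajectory_from ::
    "real ^ 's::finite ^ 'a::finite ^ 's \<Rightarrow> real ^ 'a ^ 's \<Rightarrow> 's \<Rightarrow> (nat \<Rightarrow> 's \<times> 'a) measure" where
  "trajectory_from P \<pi> s = trajectory P \<pi> (map_pmf (Pair s) (vec_pmf (\<pi> $ s)))"

definition discounted_cost ::
    "('s \<Rightarrow> 'a \<Rightarrow> real) \<Rightarrow> real \<Rightarrow> (nat \<Rightarrow> 's \<times> 'a) \<Rightarrow> real" where
  "discounted_cost c \<gamma> \<omega> = (\<Sum>t. \<gamma> ^ t * c (fst (\<omega> t)) (snd (\<omega> t)))"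


section \<open>Values and visitation measures\<close>

definition V_val ::
    "('s::finite \<Rightarrow> 'a::finite \<Rightarrow> real) \<Rightarrow> real \<Rightarrow> real ^ 's ^ 'a ^ 's \<Rightarrow> real ^ 'a ^ 's \<Rightarrow>
     's \<Rightarrow> real" where
  "V_val c \<gamma> P \<pi> s = (\<integral>\<omega>. discounted_cost c \<gamma> \<omega> \<partial>trajectory_from P \<pi> s)"

definition Q_val ::
    "('s::finite \<Rightarrow> 'a::finite \<Rightarrow> real) \<Rightarrow> real \<Rightarrow> real ^ 's ^ 'a ^ 's \<Rightarrow> real ^ 'a ^ 's \<Rightarrow>
     's \<Rightarrow> 'a \<Rightarrow> real" where
  "Q_val c \<gamma> P \<pi> s a = (\<integral>\<omega>. discounted_cost c \<gamma> \<omega> \<partial>trajectory P \<pi> (return_pmf (s, a)))"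

text \<open>The values are bounded and continuous in \<open>u\<close>, so the suprema over the compact set \<open>U\<close> are
  maxima.\<close>

definition V_rob ::
    "('s::finite \<Rightarrow> 'a::finite \<Rightarrow> real) \<Rightarrow> real \<Rightarrow> real ^ 's ^ 'a ^ 's \<Rightarrow>
     (real ^ 's ^ 'a ^ 's) set \<Rightarrow> real ^ 'a ^ 's \<Rightarrow> 's \<Rightarrow> real" where
  "V_rob c \<gamma> PN U \<pi> s = (SUP u\<in>U. V_val c \<gamma> (PN + u) \<pi> s)"

definition Q_rob ::
    "('s::finite \<Rightarrow> 'a::finite \<Rightarrow> real) \<Rightarrow> real \<Rightarrow> real ^ 's ^ 'a ^ 's \<Rightarrow>
     (real ^ 's ^ 'a ^ 's) set \<Rightarrow> real ^ 'a ^ 's \<Rightarrow> 's \<Rightarrow> 'a \<Rightarrow> real" where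
  "Q_rob c \<gamma> PN U \<pi> s a = (SUP u\<in>U. Q_val c \<gamma> (PN + u) \<pi> s a)"

definition objective ::
    "('s::finite \<Rightarrow> 'a::finite \<Rightarrow> real) \<Rightarrow> real \<Rightarrow> real ^ 's ^ 'a ^ 's \<Rightarrow>
     (real ^ 's ^ 'a ^ 's) set \<Rightarrow> real ^ 's \<Rightarrow> real ^ 'a ^ 's \<Rightarrow> real" where
  "objective c \<gamma> PN U \<rho> \<pi> = (\<Sum>s\<in>UNIV. \<rho> $ s * V_rob c \<gamma> PN U \<pi> s)"

definition optimal_robust ::
    "('s::finite \<Rightarrow> 'a::finite \<Rightarrow> real) \<Rightarrow> real \<Rightarrow> real ^ 's ^ 'a ^ 's \<Rightarrow>
     (real ^ 's ^ 'a ^ 's) set \<Rightarrow> real ^ 'a ^ 's \<Rightarrow> bool" where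
  "optimal_robust c \<gamma> PN U \<pi>opt \<longleftrightarrow> \<pi>opt \<in> policies \<and>
     (\<forall>\<pi>\<in>policies. \<forall>s. V_rob c \<gamma> PN U \<pi>opt s \<le> V_rob c \<gamma> PN U \<pi> s)"

definition visitation ::
    "real \<Rightarrow> real ^ 's::finite ^ 'a::finite ^ 's \<Rightarrow> real ^ 'a ^ 's \<Rightarrow> 's \<Rightarrow> 's \<Rightarrow> real" where
  "visitation \<gamma> P \<pi> s s' =
     (1 - \<gamma>) * (\<Sum>t. \<gamma> ^ t * measure (trajectory_from P \<pi> s) {\<omega>. fst (\<omega> t) = s'})"

definition visitation_avg ::
    "real \<Rightarrow> real ^ 's::finite ^ 'a::finite ^ 's \<Rightarrow> real ^ 'a ^ 's \<Rightarrow> real ^ 's \<Rightarrow> 's \<Rightarrow> real" where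
  "visitation_avg \<gamma> P \<pi> \<rho> s' = (\<Sum>s\<in>UNIV. \<rho> $ s * visitation \<gamma> P \<pi> s s')"

text \<open>\<open>\<parallel>\<mu> / \<nu>\<parallel>\<^sub>\<infinity>\<close> for nonnegative \<open>\<mu>\<close> and \<open>\<nu>\<close>. Division in \<^typ>\<open>ennreal\<close> gives \<open>x / 0 = \<infinity>\<close> for
  \<open>x > 0\<close> and \<open>0 / 0 = 0\<close>, so the value is finite iff \<open>\<mu>\<close> is absolutely continuous with respect
  to \<open>\<nu>\<close>.\<close>

definition ratio_norm :: "('s::finite \<Rightarrow> real) \<Rightarrow> ('s \<Rightarrow> real) \<Rightarrow> ennreal" where
  "ratio_norm \<mu> \<nu> = (SUP s. ennreal (\<mu> s) / ennreal (\<nu> s))"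


section \<open>Robust policy mirror descent\<close>

definition strictly_convex :: "('b::real_vector \<Rightarrow> real) \<Rightarrow> bool" where
  "strictly_convex w \<longleftrightarrow> (\<forall>x y t. x \<noteq> y \<longrightarrow> 0 < t \<longrightarrow> t < 1 \<longrightarrow>
     w ((1 - t) *\<^sub>R x + t *\<^sub>R y) < (1 - t) * w x + t * w y)"

definition subgradient :: "('b::real_inner \<Rightarrow> real) \<Rightarrow> 'b \<Rightarrow> 'b \<Rightarrow> bool" where
  "subgradient w p g \<longleftrightarrow> (\<forall>q. w p + inner g (q - p) \<le> w q)"

text \<open>Bregman divergence of \<open>p\<close> from \<open>q\<close>, formed with the subgradient \<open>g\<close> of \<open>w\<close> at \<open>q\<close>.\<close>

definition bregman :: "('b::real_inner \<Rightarrow> real) \<Rightarrow> 'b \<Rightarrow> 'b \<Rightarrow> 'b \<Rightarrow> real" where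
  "bregman w g p q = w p - w q - inner g (p - q)"

text \<open>\<open>g k $ s\<close> is the subgradient of \<open>w\<close> used at \<open>\<pi> k $ s\<close>. The last clause is the first-order
  optimality condition of the update, with \<open>g (Suc k) $ s\<close> as the subgradient of \<open>w\<close> at the
  minimizer; it is required only where \<open>w\<close> is not differentiable, as elsewhere the subgradient
  is unique.\<close>

definition rpmd ::
    "('s::finite \<Rightarrow> 'a::finite \<Rightarrow> real) \<Rightarrow> real \<Rightarrow> real ^ 's ^ 'a ^ 's \<Rightarrow>
     (real ^ 's ^ 'a ^ 's) set \<Rightarrow> (real ^ 'a \<Rightarrow> real) \<Rightarrow> (nat \<Rightarrow> real) \<Rightarrow>
     (nat \<Rightarrow> real ^ 'a ^ 's) \<Rightarrow> (nat \<Rightarrow> real ^ 'a ^ 's) \<Rightarrow> bool" where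
  "rpmd c \<gamma> PN U w \<eta> g \<pi> \<longleftrightarrow>
     \<pi> 0 \<in> policies \<and>
     (\<forall>k s. subgradient w (\<pi> k $ s) (g k $ s)) \<and>
     (\<forall>k s. is_arg_min
        (\<lambda>p. \<eta> k * inner (\<chi> a. Q_rob c \<gamma> PN U (\<pi> k) s a) p + bregman w (g k $ s) p (\<pi> k $ s))
        (\<lambda>p. p \<in> prob_simplex) (\<pi> (Suc k) $ s)) \<and>
     (\<forall>k s. \<not> w differentiable (at (\<pi> (Suc k) $ s)) \<longrightarrow>
        (\<forall>p\<in>prob_simplex.
           0 \<le> inner (\<eta> k *\<^sub>R (\<chi> a. Q_rob c \<gamma> PN U (\<pi> k) s a) + g (Suc k) $ s - g k $ s)
                  (p - \<pi> (Suc k) $ s)))"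

definition initial_divergences ::
    "(real ^ 'a::finite \<Rightarrow> real) \<Rightarrow> real ^ 'a ^ 's::finite \<Rightarrow> real ^ 'a ^ 's \<Rightarrow> real set" where
  "initial_divergences w g0 \<pi>0 = {bregman w (g0 $ s) (\<pi> $ s) (\<pi>0 $ s) | \<pi> s. \<pi> \<in> policies}"

end

theory Submission
  imports Defs
begin

text \<open>
  By rectangularity a single kernel attains all the suprema \<open>V_rob \<pi> s\<close> and \<open>Q_rob \<pi> s a\<close>: if \<open>u\<close>
  is a worst case for the next-state values \<open>V_rob \<pi>\<close>, then \<open>V_rob \<pi> \<le> T\<^sub>u (V_rob \<pi>)\<close> for the
  Bellman operator \<open>T\<^sub>u\<close> of \<open>\<pi>\<close> under \<open>PN + u\<close>, hence \<open>V_rob \<pi> \<le> V_val (PN + u) \<pi>\<close>. This yields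
  two performance inequalities. For the optimal policy, with \<open>u\<^sub>k\<close> worst for \<open>\<pi>\<^sub>k\<close>,
  \<open>(1 - \<gamma>) (V_rob \<pi>\<^sub>k - V_rob \<pi>opt)\<close> is at most the \<open>d\<^sub>k\<close>-average of \<open>\<langle>Q\<^sub>k, \<pi>\<^sub>k - \<pi>opt\<rangle>\<close>, where \<open>d\<^sub>k\<close> is
  the visitation measure of \<open>\<pi>opt\<close> under \<open>u\<^sub>k\<close>. For consecutive iterates,
  \<open>V_rob \<pi>\<^sub>k\<^sub>+\<^sub>1 - V_rob \<pi>\<^sub>k \<le> \<langle>Q\<^sub>k, \<pi>\<^sub>k\<^sub>+\<^sub>1 - \<pi>\<^sub>k\<rangle> \<le> 0\<close> pointwise, which turns \<open>d\<^sub>k\<close> into \<open>M \<rho>\<close>.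
  Averaging the three-point inequality of mirror descent over \<open>d\<^sub>k\<close> then bounds
  \<open>\<eta>\<^sub>k M (f\<^sub>k\<^sub>+\<^sub>1 - f\<^sub>k) + \<eta>\<^sub>k (1 - \<gamma>) (f\<^sub>k - f\<^sub>*)\<close> by a difference of averaged divergences. Passing from
  \<open>d\<^sub>k\<close> to \<open>d\<^sub>k\<^sub>+\<^sub>1\<close> costs a factor \<open>M'\<close>, which the growth of the stepsizes absorbs.
\<close>

section \<open>Marginals of the trajectory\<close>

text \<open>Values and visitation measures depend on a trajectory only through its one-time laws.
  Computing these as pmfs on a finite type replaces the infinite product measure by finite
  sums.\<close>

primrec marginal ::
    "real ^ 's::finite ^ 'a::finite ^ 's \<Rightarrow> real ^ 'a ^ 's \<Rightarrow> ('s \<times> 'a) pmf \<Rightarrow> nat \<Rightarrow> ('s \<times> 'a) pmf"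
  where
    "marginal P \<pi> \<mu> 0 = \<mu>"
  | "marginal P \<pi> \<mu> (Suc t) = bind_pmf (marginal P \<pi> \<mu> t) (step_pmf P \<pi>)"

lemma marginal_bind: "marginal P \<pi> (bind_pmf \<mu> f) t = bind_pmf \<mu> (\<lambda>x. marginal P \<pi> (f x) t)"
  by (induction t) (simp_all add: bind_assoc_pmf)

text \<open>Peels off the first transition, whereas the recursion appends the last one; first-step
  analysis needs this form.\<close>

lemma marginal_Suc: "marginal P \<pi> \<mu> (Suc t) = marginal P \<pi> (bind_pmf \<mu> (step_pmf P \<pi>)) t"
  by (induction t) simp_all

text \<open>\<open>eP n\<close> extends a history by a coordinate drawn from \<open>P n\<close>, so
  projecting onto that coordinate recovers \<open>P n\<close>.\<close>

lemma (in Ionescu_Tulcea) distr_C_Suc: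
  assumes \<omega>: "\<omega> \<in> space (PiM {0..<0} M)"
  shows "distr (C 0 (Suc n) \<omega>) (M n) (\<lambda>\<omega>'. \<omega>' n) = C 0 n \<omega> \<bind> P n"
proof -
  have "distr (C 0 (Suc n) \<omega>) (M n) (\<lambda>\<omega>'. \<omega>' n) = distr (C 0 n \<omega> \<bind> eP n) (M n) (\<lambda>\<omega>'. \<omega>' n)"
    by simp
  also have "\<dots> = C 0 n \<omega> \<bind> (\<lambda>\<omega>'. distr (eP n \<omega>') (M n) (\<lambda>\<omega>'. \<omega>' n))"
  proof (rule distr_bind[where K="PiM {0..<Suc n} M"])
    show "eP n \<in> measurable (C 0 n \<omega>) (subprob_algebra (PiM {0..<Suc n} M))"
      using measurable_eP[of n] by (simp add: measurable_cong_sets[OF sets_C[OF \<omega>] refl])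
    show "space (C 0 n \<omega>) \<noteq> {}"
      using prob_space_C[OF \<omega>] by (rule prob_space.not_empty)
    show "(\<lambda>\<omega>'. \<omega>' n) \<in> measurable (PiM {0..<Suc n} M) (M n)"
      by (rule measurable_component_singleton) simp
  qed
  also have "\<dots> = C 0 n \<omega> \<bind> P n"
  proof (rule bind_cong[OF refl])
    fix \<omega>' assume "\<omega>' \<in> space (C 0 n \<omega>)"
    then have \<omega>': "\<omega>' \<in> space (PiM {0..<n} M)"
      using space_C[OF \<omega>, of n] by simp
    have "fun_upd \<omega>' n \<in> measurable (P n \<omega>') (PiM {0..<Suc n} M)"
      using \<omega>' by (intro measurable_fun_upd[where J="{0..<n}"])
        (auto simp: measurable_cong_sets[OF sets_P[OF \<omega>'] refl])
    then have "distr (eP n \<omega>') (M n) (\<lambda>\<omega>'. \<omega>' n) = distr (P n \<omega>') (M n) (\<lambda>x. x)"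
      unfolding eP_def by (subst distr_distr) (auto simp: comp_def intro!: measurable_component_singleton)
    also have "\<dots> = P n \<omega>'"
      by (rule distr_id2) (simp add: sets_P[OF \<omega>'])
    finally show "distr (eP n \<omega>') (M n) (\<lambda>\<omega>'. \<omega>' n) = P n \<omega>'" .
  qed
  finally show ?thesis .
qed

text \<open>The finite-horizon measures \<open>IT.C 0 (Suc t)\<close> are treated by induction on
  the horizon, and the projective limit has the same coordinate laws.\<close>

lemma distr_trajectory:
  fixes P :: "real ^ 's::finite ^ 'a::finite ^ 's"
  shows "distr (trajectory P \<pi> \<mu>) (count_space UNIV) (\<lambda>\<omega>. \<omega> t) = measure_pmf (marginal P \<pi> \<mu> t)"
proof -
  interpret IT: Ionescu_Tulcea "traj_kernel P \<pi> \<mu>" "\<lambda>_. count_space UNIV"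
    by (rule Ionescu_Tulcea_traj_kernel)
  let ?M = "\<lambda>_::nat. count_space (UNIV :: ('s \<times> 'a) set)"
  let ?u = "\<lambda>_::nat. undefined :: 's \<times> 'a"
  have u: "?u \<in> space (PiM {0..<0} ?M)"
    by (simp add: space_PiM)
  have ms: "(\<lambda>\<omega>. \<omega> i) \<in> measurable (PiM I ?M) (count_space UNIV)" if "i \<in> I" for i I
    using that by (rule measurable_component_singleton)
  have C: "distr (IT.C 0 (Suc t) ?u) (count_space UNIV) (\<lambda>\<omega>. \<omega> t) = measure_pmf (marginal P \<pi> \<mu> t)" for t
  proof (induction t)
    case 0
    have "distr (IT.C 0 (Suc 0) ?u) (count_space UNIV) (\<lambda>\<omega>. \<omega> 0)
        = IT.C 0 0 ?u \<bind> traj_kernel P \<pi> \<mu> 0"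
      by (rule IT.distr_C_Suc[OF u])
    also have "\<dots> = traj_kernel P \<pi> \<mu> 0 ?u"
      unfolding IT.C.simps using IT.P[of 0] u by (intro bind_return[where N="count_space UNIV"]) simp_all
    also have "\<dots> = measure_pmf (marginal P \<pi> \<mu> 0)"
      by (simp add: traj_kernel_def)
    finally show ?case .
  next
    case (Suc t)
    have sC: "sets (IT.C 0 (Suc t) ?u) = sets (PiM {0..<Suc t} ?M)"
      using IT.sets_C[OF u, of "Suc t"] by simp
    have "distr (IT.C 0 (Suc (Suc t)) ?u) (count_space UNIV) (\<lambda>\<omega>. \<omega> (Suc t))
        = IT.C 0 (Suc t) ?u \<bind> traj_kernel P \<pi> \<mu> (Suc t)"
      by (rule IT.distr_C_Suc[OF u])
    \<comment> \<open>The kernel reads only the last pair of the history, so integrating over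
      histories reduces to integrating over the law of coordinate \<open>t\<close>, which the
      induction hypothesis identifies.\<close>
    also have "traj_kernel P \<pi> \<mu> (Suc t) = (\<lambda>\<omega>. measure_pmf (step_pmf P \<pi> (\<omega> t)))"
      by (simp add: traj_kernel_def fun_eq_iff)
    also have "IT.C 0 (Suc t) ?u \<bind> (\<lambda>\<omega>. measure_pmf (step_pmf P \<pi> (\<omega> t)))
        = distr (IT.C 0 (Suc t) ?u) (count_space UNIV) (\<lambda>\<omega>. \<omega> t)
          \<bind> (\<lambda>x. measure_pmf (step_pmf P \<pi> x))"
    proof (rule bind_distr[symmetric, where K="count_space UNIV"])
      show "(\<lambda>\<omega>. \<omega> t) \<in> measurable (IT.C 0 (Suc t) ?u) (count_space UNIV)"
        using ms[of t "{0..<Suc t}"] by (simp add: measurable_cong_sets[OF sC refl] del: IT.C.simps)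
      show "space (IT.C 0 (Suc t) ?u) \<noteq> {}"
        using IT.prob_space_C[OF u] by (rule prob_space.not_empty)
    qed (auto intro!: measure_pmf_in_subprob_algebra)
    also have "\<dots> = measure_pmf (marginal P \<pi> \<mu> (Suc t))"
      by (simp only: Suc.IH marginal.simps measure_pmf_bind)
    finally show ?case .
  qed
  \<comment> \<open>\<open>Suc t\<close> is the least horizon containing the coordinate
    \<open>t\<close>, so the limit restricted to \<open>{t}\<close> is a projection of
    \<open>IT.C 0 (Suc t)\<close>.\<close>
  have up: "IT.up_to {t} = Suc t"
    using IT.up_to_iff[of "{t}" "Suc t"] IT.up_to_less[of "{t}" t] by simp
  have sC: "sets (IT.C 0 (Suc t) ?u) = sets (PiM {0..<Suc t} ?M)"
    using IT.sets_C[OF u, of "Suc t"] by simp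
  have r: "(\<lambda>\<omega>. restrict \<omega> {t}) \<in> measurable (PiM I ?M) (PiM {t} ?M)" if "t \<in> I" for I
    using that by (intro measurable_restrict_subset) simp
  have lim: "trajectory P \<pi> \<mu> = IT.PF.lim"
    by (simp add: trajectory_def)
  have "distr IT.PF.lim (count_space UNIV) (\<lambda>\<omega>. \<omega> t)
      = distr (distr IT.PF.lim (PiM {t} ?M) (\<lambda>\<omega>. restrict \<omega> {t})) (count_space UNIV) (\<lambda>\<omega>. \<omega> t)"
    using r[of UNIV] ms[of t "{t}"]
    by (subst distr_distr) (simp_all add: comp_def measurable_cong_sets[OF IT.PF.sets_lim refl])
  also have "\<dots> = distr (IT.CI {t}) (count_space UNIV) (\<lambda>\<omega>. \<omega> t)"
    by (subst IT.distr_lim) simp_all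
  also have "\<dots> = distr (IT.C 0 (Suc t) ?u) (count_space UNIV) (\<lambda>\<omega>. \<omega> t)"
    unfolding IT.CI_def up using r[of "{0..<Suc t}"] ms[of t "{t}"]
    by (subst distr_distr) (simp_all add: comp_def measurable_cong_sets[OF sC refl] del: IT.C.simps)
  finally show ?thesis
    using C lim by simp
qed

lemma measurable_trajectory_component:
  fixes P :: "real ^ 's::finite ^ 'a::finite ^ 's"
  shows "(\<lambda>\<omega>. \<omega> t) \<in> measurable (trajectory P \<pi> \<mu>) (count_space UNIV)"
proof -
  interpret IT: Ionescu_Tulcea "traj_kernel P \<pi> \<mu>" "\<lambda>_. count_space UNIV"
    by (rule Ionescu_Tulcea_traj_kernel)
  show ?thesis
    unfolding trajectory_def
    by (subst measurable_cong_sets[OF IT.PF.sets_lim refl]) (rule measurable_component_singleton, simp)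
qed

lemma prob_space_trajectory: "prob_space (trajectory P \<pi> \<mu>)"
  using measurable_trajectory_component[of 0 P \<pi> \<mu>]
  by (rule prob_space_distrD) (simp add: distr_trajectory measure_pmf.prob_space_axioms)

lemma integral_trajectory_component:
  fixes h :: "'s::finite \<times> 'a::finite \<Rightarrow> real"
  shows "(\<integral>\<omega>. h (\<omega> t) \<partial>trajectory P \<pi> \<mu>) = measure_pmf.expectation (marginal P \<pi> \<mu> t) h"
  unfolding distr_trajectory[symmetric]
  by (rule integral_distr[symmetric]) (auto intro: measurable_trajectory_component)

section \<open>Discounted sums over the one-time laws\<close>

definition discounted_marginal ::
    "real \<Rightarrow> real ^ 's::finite ^ 'a::finite ^ 's \<Rightarrow> real ^ 'a ^ 's \<Rightarrow> ('s \<times> 'a \<Rightarrow> real) \<Rightarrow>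
     ('s \<times> 'a) pmf \<Rightarrow> real" where
  "discounted_marginal \<gamma> P \<pi> h \<mu> =
     (\<Sum>t. \<gamma> ^ t * measure_pmf.expectation (marginal P \<pi> \<mu> t) h)"

definition init_pmf :: "real ^ 'a::finite ^ 's::finite \<Rightarrow> 's \<Rightarrow> ('s \<times> 'a) pmf" where
  "init_pmf \<pi> s = map_pmf (Pair s) (vec_pmf (\<pi> $ s))"

text \<open>Leaving \<open>h\<close> general covers two uses: the cost gives the value of a policy,
  and the indicator of a state gives the visitation measure up to the factor
  \<open>1 - \<gamma>\<close>.\<close>

definition state_value ::
    "real \<Rightarrow> real ^ 's::finite ^ 'a::finite ^ 's \<Rightarrow> real ^ 'a ^ 's \<Rightarrow> ('s \<times> 'a \<Rightarrow> real) \<Rightarrow> 's \<Rightarrow> real" where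
  "state_value \<gamma> P \<pi> h s = discounted_marginal \<gamma> P \<pi> h (init_pmf \<pi> s)"

lemma expectation_finite_type:
  fixes h :: "'b::finite \<Rightarrow> real"
  shows "measure_pmf.expectation p h = (\<Sum>x\<in>UNIV. pmf p x * h x)"
  by (subst integral_measure_pmf_real[of UNIV]) (auto simp: mult.commute)

lemma expectation_bind_finite_type:
  fixes h :: "'b::finite \<Rightarrow> real" and p :: "'c::finite pmf"
  shows "measure_pmf.expectation (bind_pmf p f) h
    = (\<Sum>x\<in>UNIV. pmf p x * measure_pmf.expectation (f x) h)"
  by (subst pmf_expectation_bind[of UNIV]) auto

lemma abs_expectation_le:
  fixes h :: "'b::finite \<Rightarrow> real"
  shows "\<bar>measure_pmf.expectation p h\<bar> \<le> (\<Sum>x\<in>UNIV. \<bar>h x\<bar>)"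
proof -
  have "\<bar>measure_pmf.expectation p h\<bar> \<le> (\<Sum>x\<in>UNIV. \<bar>pmf p x * h x\<bar>)"
    unfolding expectation_finite_type by (rule sum_abs)
  also have "\<dots> \<le> (\<Sum>x\<in>UNIV. \<bar>h x\<bar>)"
    by (intro sum_mono) (simp add: abs_mult mult_left_le_one_le pmf_le_1)
  finally show ?thesis .
qed

lemma summable_discounted:
  fixes f :: "nat \<Rightarrow> real"
  assumes "0 \<le> \<gamma>" "\<gamma> < 1" "\<And>t. \<bar>f t\<bar> \<le> B"
  shows "summable (\<lambda>t. \<gamma> ^ t * f t)"
proof (rule summable_comparison_test')
  show "summable (\<lambda>t. B * \<gamma> ^ t)"
    using assms by (intro summable_mult summable_geometric) simp
  show "norm (\<gamma> ^ t * f t) \<le> B * \<gamma> ^ t" for t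
    using assms mult_left_mono[of "\<bar>f t\<bar>" B "\<gamma> ^ t"] by (simp add: abs_mult mult.commute)
qed

context
  fixes \<gamma> :: real
  assumes \<gamma>: "0 \<le> \<gamma>" "\<gamma> < 1"
begin

lemma summable_discounted_marginal:
  "summable (\<lambda>t. \<gamma> ^ t * measure_pmf.expectation (marginal P \<pi> \<mu> t) h)"
  using \<gamma> abs_expectation_le by (rule summable_discounted)

text \<open>Linearity in the initial law: \<open>marginal_bind\<close> holds at each time, and a
  finite sum may be exchanged with summable series.\<close>

lemma discounted_marginal_bind:
  fixes \<mu> :: "'c::finite pmf"
  shows "discounted_marginal \<gamma> P \<pi> h (bind_pmf \<mu> f)
    = (\<Sum>x\<in>UNIV. pmf \<mu> x * discounted_marginal \<gamma> P \<pi> h (f x))"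
proof -
  have "discounted_marginal \<gamma> P \<pi> h (bind_pmf \<mu> f)
      = (\<Sum>t. \<Sum>x\<in>UNIV. pmf \<mu> x * (\<gamma> ^ t * measure_pmf.expectation (marginal P \<pi> (f x) t) h))"
    unfolding discounted_marginal_def marginal_bind expectation_bind_finite_type
    by (simp add: sum_distrib_left algebra_simps)
  also have "\<dots> = (\<Sum>x\<in>UNIV. \<Sum>t. pmf \<mu> x * (\<gamma> ^ t * measure_pmf.expectation (marginal P \<pi> (f x) t) h))"
    by (rule suminf_sum) (intro summable_mult summable_discounted_marginal)
  also have "\<dots> = (\<Sum>x\<in>UNIV. pmf \<mu> x * discounted_marginal \<gamma> P \<pi> h (f x))"
    unfolding discounted_marginal_def
    by (intro sum.cong refl suminf_mult summable_discounted_marginal)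
  finally show ?thesis .
qed

text \<open>First-step analysis: the head of the series is \<open>h x\<close>, and the shifted tail
  restarts from \<open>step_pmf P \<pi> x\<close>.\<close>

lemma discounted_marginal_return:
  "discounted_marginal \<gamma> P \<pi> h (return_pmf x)
    = h x + \<gamma> * discounted_marginal \<gamma> P \<pi> h (step_pmf P \<pi> x)"
proof -
  let ?f = "\<lambda>\<mu> t. \<gamma> ^ t * measure_pmf.expectation (marginal P \<pi> \<mu> t) h"
  have "(\<Sum>t. ?f (return_pmf x) (Suc t)) = (\<Sum>t. \<gamma> * ?f (step_pmf P \<pi> x) t)"
    by (simp add: marginal_Suc bind_return_pmf mult.assoc del: marginal.simps)
  also have "\<dots> = \<gamma> * discounted_marginal \<gamma> P \<pi> h (step_pmf P \<pi> x)"
    unfolding discounted_marginal_def by (intro suminf_mult summable_discounted_marginal)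
  finally show ?thesis
    using suminf_split_head[OF summable_discounted_marginal, of P \<pi> "return_pmf x" h]
    by (simp add: discounted_marginal_def)
qed

text \<open>Series and integral are exchanged by absolute summability: on a finite type the cost is
  bounded by \<open>?B\<close>, so the terms are dominated by a geometric series.\<close>

lemma integral_discounted_cost:
  fixes c :: "'s::finite \<Rightarrow> 'a::finite \<Rightarrow> real"
  shows "(\<integral>\<omega>. discounted_cost c \<gamma> \<omega> \<partial>trajectory P \<pi> \<mu>)
    = discounted_marginal \<gamma> P \<pi> (\<lambda>(s, a). c s a) \<mu>"
proof -
  interpret T: prob_space "trajectory P \<pi> \<mu>"
    by (rule prob_space_trajectory)
  let ?h = "\<lambda>(s, a). c s a"
  let ?B = "\<Sum>x\<in>UNIV. \<bar>?h x\<bar>"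
  have m: "(\<lambda>\<omega>. ?h (\<omega> t)) \<in> borel_measurable (trajectory P \<pi> \<mu>)" for t
    by (rule measurable_compose[OF measurable_trajectory_component]) simp
  have b: "\<bar>?h x\<bar> \<le> ?B" for x
    by (rule member_le_sum) auto
  have int: "integrable (trajectory P \<pi> \<mu>) (\<lambda>\<omega>. ?h (\<omega> t))" for t
    using m b by (intro T.integrable_const_bound[where B="?B"]) auto
  have "(\<integral>\<omega>. discounted_cost c \<gamma> \<omega> \<partial>trajectory P \<pi> \<mu>)
      = (\<integral>\<omega>. (\<Sum>t. \<gamma> ^ t * ?h (\<omega> t)) \<partial>trajectory P \<pi> \<mu>)"
    by (simp add: discounted_cost_def case_prod_unfold)
  also have "\<dots> = (\<Sum>t. \<integral>\<omega>. \<gamma> ^ t * ?h (\<omega> t) \<partial>trajectory P \<pi> \<mu>)"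
  proof (rule integral_suminf)
    show "integrable (trajectory P \<pi> \<mu>) (\<lambda>\<omega>. \<gamma> ^ t * ?h (\<omega> t))" for t
      using int by simp
    show "AE \<omega> in trajectory P \<pi> \<mu>. summable (\<lambda>t. norm (\<gamma> ^ t * ?h (\<omega> t)))"
      using \<gamma> by (auto simp: abs_mult intro!: summable_discounted[where B="?B"] b)
    have "\<bar>\<integral>\<omega>. \<bar>?h (\<omega> t)\<bar> \<partial>trajectory P \<pi> \<mu>\<bar> \<le> ?B" for t
      using integral_trajectory_component[where h="\<lambda>x. \<bar>?h x\<bar>" and t=t]
        abs_expectation_le[of "marginal P \<pi> \<mu> t" "\<lambda>x. \<bar>?h x\<bar>"]
      by (simp add: case_prod_unfold)
    then show "summable (\<lambda>t. \<integral>\<omega>. norm (\<gamma> ^ t * ?h (\<omega> t)) \<partial>trajectory P \<pi> \<mu>)"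
      using \<gamma> by (auto simp: abs_mult intro!: summable_discounted[where B="?B"])
  qed
  also have "\<dots> = discounted_marginal \<gamma> P \<pi> ?h \<mu>"
    unfolding discounted_marginal_def
    by (simp add: integral_trajectory_component)
  finally show ?thesis .
qed

lemma state_value_eq:
  assumes "\<pi> \<in> policies"
  shows "state_value \<gamma> P \<pi> h s = (\<Sum>a\<in>UNIV. \<pi> $ s $ a * discounted_marginal \<gamma> P \<pi> h (return_pmf (s, a)))"
  using assms unfolding state_value_def init_pmf_def map_pmf_def
  by (simp add: discounted_marginal_bind policies_def pmf_vec_pmf)

lemma discounted_marginal_return_eq:
  assumes "P \<in> kernels"
  shows "discounted_marginal \<gamma> P \<pi> h (return_pmf (s, a))
    = h (s, a) + \<gamma> * (\<Sum>s'\<in>UNIV. P $ s $ a $ s' * state_value \<gamma> P \<pi> h s')"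
  using assms unfolding state_value_def init_pmf_def
  by (simp add: discounted_marginal_return step_pmf_def discounted_marginal_bind kernels_def pmf_vec_pmf)

end

section \<open>The state chain induced by a policy and its maximum principle\<close>

definition induced :: "real ^ 's::finite ^ 'a::finite ^ 's \<Rightarrow> real ^ 'a ^ 's \<Rightarrow> 's \<Rightarrow> 's \<Rightarrow> real" where
  "induced P \<pi> s s' = (\<Sum>a\<in>UNIV. \<pi> $ s $ a * P $ s $ a $ s')"

lemma induced_nonneg: "P \<in> kernels \<Longrightarrow> \<pi> \<in> policies \<Longrightarrow> 0 \<le> induced P \<pi> s s'"
  by (auto simp: induced_def kernels_def policies_def prob_simplex_def intro!: sum_nonneg)

lemma sum_induced: "(\<Sum>s'\<in>UNIV. induced P \<pi> s s' * x s')
    = (\<Sum>a\<in>UNIV. \<pi> $ s $ a * (\<Sum>s'\<in>UNIV. P $ s $ a $ s' * x s'))"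
  unfolding induced_def sum_distrib_right sum_distrib_left
  by (subst sum.swap) (simp add: mult.assoc)

lemma sum_induced_1: "P \<in> kernels \<Longrightarrow> \<pi> \<in> policies \<Longrightarrow> (\<Sum>s'\<in>UNIV. induced P \<pi> s s') = 1"
  using sum_induced[of P \<pi> s "\<lambda>_. 1"] by (simp add: kernels_def policies_def prob_simplex_def)

text \<open>At a state \<open>s0\<close> maximising \<open>x\<close> the average is at most
  \<open>x s0\<close>, so \<open>x s0 \<le> \<gamma> * x s0\<close>, which forces
  \<open>x s0 \<le> 0\<close>. This takes the place of contraction arguments when Bellman recursions
  are compared.\<close>

lemma induced_max_principle:
  fixes P :: "real ^ 's::finite ^ 'a::finite ^ 's"
  assumes P: "P \<in> kernels" and \<pi>: "\<pi> \<in> policies" and \<gamma>: "0 \<le> \<gamma>" "\<gamma> < 1"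
    and le: "\<And>s. x s \<le> \<gamma> * (\<Sum>s'\<in>UNIV. induced P \<pi> s s' * x s')"
  shows "x s \<le> 0"
proof -
  have "Max (range x) \<in> range x"
    by simp
  then obtain s0 where "x s0 = Max (range x)"
    by (metis imageE)
  then have s0: "x s \<le> x s0" for s
    by simp
  have "(\<Sum>s'\<in>UNIV. induced P \<pi> s0 s' * x s') \<le> (\<Sum>s'\<in>UNIV. induced P \<pi> s0 s' * x s0)"
    by (intro sum_mono mult_left_mono s0 induced_nonneg P \<pi>)
  also have "\<dots> = x s0"
    by (simp add: sum_distrib_right[symmetric] sum_induced_1 P \<pi>)
  finally have "x s0 \<le> \<gamma> * x s0"
    using le[of s0] \<gamma> by (meson mult_left_mono order_trans)
  then have "(1 - \<gamma>) * x s0 \<le> 0"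
    by (simp add: algebra_simps)
  then have "x s0 \<le> 0"
    using \<gamma> by (simp add: mult_le_0_iff)
  then show ?thesis
    using s0[of s] by simp
qed

section \<open>Bellman equations and visitation measures\<close>

lemma trajectory_from_eq: "trajectory_from P \<pi> s = trajectory P \<pi> (init_pmf \<pi> s)"
  by (simp add: trajectory_from_def init_pmf_def)

lemma V_val_eq_state_value:
  "0 \<le> \<gamma> \<Longrightarrow> \<gamma> < 1 \<Longrightarrow> V_val c \<gamma> P \<pi> s = state_value \<gamma> P \<pi> (\<lambda>(s, a). c s a) s"
  by (simp add: V_val_def trajectory_from_eq integral_discounted_cost state_value_def)

lemma V_val_eq_Q_val:
  "0 \<le> \<gamma> \<Longrightarrow> \<gamma> < 1 \<Longrightarrow> \<pi> \<in> policies \<Longrightarrow>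
    V_val c \<gamma> P \<pi> s = (\<Sum>a\<in>UNIV. \<pi> $ s $ a * Q_val c \<gamma> P \<pi> s a)"
  by (simp add: V_val_eq_state_value state_value_eq Q_val_def integral_discounted_cost)

lemma Q_val_bellman:
  "0 \<le> \<gamma> \<Longrightarrow> \<gamma> < 1 \<Longrightarrow> P \<in> kernels \<Longrightarrow>
    Q_val c \<gamma> P \<pi> s a = c s a + \<gamma> * (\<Sum>s'\<in>UNIV. P $ s $ a $ s' * V_val c \<gamma> P \<pi> s')"
  by (simp add: V_val_eq_state_value discounted_marginal_return_eq Q_val_def integral_discounted_cost)

lemma space_trajectory:
  fixes P :: "real ^ 's::finite ^ 'a::finite ^ 's"
  shows "space (trajectory P \<pi> \<mu>) = UNIV"
proof -
  interpret IT: Ionescu_Tulcea "traj_kernel P \<pi> \<mu>" "\<lambda>_. count_space UNIV"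
    by (rule Ionescu_Tulcea_traj_kernel)
  show ?thesis
    by (simp add: trajectory_def space_PiM)
qed

lemma visitation_eq_state_value:
  "visitation \<gamma> P \<pi> s s' = (1 - \<gamma>) * state_value \<gamma> P \<pi> (\<lambda>x. of_bool (fst x = s')) s"
proof -
  have "measure (trajectory P \<pi> \<mu>) {\<omega>. fst (\<omega> t) = s'}
      = measure_pmf.expectation (marginal P \<pi> \<mu> t) (\<lambda>x. of_bool (fst x = s'))" for \<mu> t
  proof -
    have "measure (trajectory P \<pi> \<mu>) {\<omega>. fst (\<omega> t) = s'}
        = measure (distr (trajectory P \<pi> \<mu>) (count_space UNIV) (\<lambda>\<omega>. \<omega> t)) {x. fst x = s'}"
      by (subst measure_distr) (auto simp: measurable_trajectory_component space_trajectory vimage_def)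
    also have "\<dots> = measure_pmf.expectation (marginal P \<pi> \<mu> t) (indicator {x. fst x = s'})"
      by (simp add: distr_trajectory)
    also have "indicator {x. fst x = s'} = (\<lambda>x. of_bool (fst x = s') :: real)"
      by (auto simp: indicator_def)
    finally show ?thesis .
  qed
  then show ?thesis
    by (simp add: visitation_def trajectory_from_eq state_value_def discounted_marginal_def)
qed

context
  fixes \<gamma> :: real and P :: "real ^ 's::finite ^ 'a::finite ^ 's" and \<pi> :: "real ^ 'a ^ 's"
  assumes \<gamma>: "0 \<le> \<gamma>" "\<gamma> < 1" and P: "P \<in> kernels" and \<pi>: "\<pi> \<in> policies"
begin

lemma visitation_bellman:
  "visitation \<gamma> P \<pi> s s'
    = (1 - \<gamma>) * of_bool (s = s') + \<gamma> * (\<Sum>t\<in>UNIV. induced P \<pi> s t * visitation \<gamma> P \<pi> t s')"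
proof -
  let ?v = "state_value \<gamma> P \<pi> (\<lambda>x. of_bool (fst x = s'))"
  have "?v s = (\<Sum>a\<in>UNIV. \<pi> $ s $ a * (of_bool (s = s') + \<gamma> * (\<Sum>t\<in>UNIV. P $ s $ a $ t * ?v t)))"
    using \<gamma> P \<pi> by (simp add: state_value_eq discounted_marginal_return_eq)
  also have "\<dots> = (\<Sum>a\<in>UNIV. \<pi> $ s $ a) * of_bool (s = s') + \<gamma> * (\<Sum>t\<in>UNIV. induced P \<pi> s t * ?v t)"
    unfolding sum_induced
    by (simp add: distrib_left sum.distrib sum_distrib_left sum_distrib_right mult.left_commute)
  also have "(\<Sum>a\<in>UNIV. \<pi> $ s $ a) = 1"
    using \<pi> by (simp add: policies_def prob_simplex_def)
  finally have "(1 - \<gamma>) * ?v s = (1 - \<gamma>) * (of_bool (s = s') + \<gamma> * (\<Sum>t\<in>UNIV. induced P \<pi> s t * ?v t))"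
    by simp
  also have "\<dots> = (1 - \<gamma>) * of_bool (s = s')
      + \<gamma> * (\<Sum>t\<in>UNIV. induced P \<pi> s t * ((1 - \<gamma>) * ?v t))"
    by (simp add: distrib_left sum_distrib_left mult.left_commute)
  finally show ?thesis
    by (simp only: visitation_eq_state_value)
qed

text \<open>The negated measure satisfies the Bellman recursion with a nonpositive source, so the
  maximum principle applies.\<close>

lemma visitation_nonneg: "0 \<le> visitation \<gamma> P \<pi> s s'"
proof -
  have "- visitation \<gamma> P \<pi> s s' \<le> 0"
  proof (rule induced_max_principle[OF P \<pi> \<gamma>, where x="\<lambda>s. - visitation \<gamma> P \<pi> s s'"])
    fix s
    show "- visitation \<gamma> P \<pi> s s' \<le> \<gamma> * (\<Sum>t\<in>UNIV. induced P \<pi> s t * - visitation \<gamma> P \<pi> t s')"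
      using visitation_bellman[of s s'] \<gamma> by (simp add: sum_negf)
  qed
  then show ?thesis by simp
qed

text \<open>The source term of the Bellman equation alone contributes \<open>1 - \<gamma>\<close>;
  the rest is nonnegative.\<close>

lemma visitation_self_ge: "1 - \<gamma> \<le> visitation \<gamma> P \<pi> s s"
proof -
  have "0 \<le> \<gamma> * (\<Sum>t\<in>UNIV. induced P \<pi> s t * visitation \<gamma> P \<pi> t s)"
    using \<gamma> by (intro mult_nonneg_nonneg sum_nonneg induced_nonneg[OF P \<pi>] visitation_nonneg)
  then show ?thesis
    using visitation_bellman[of s s] by simp
qed

lemma visitation_sum_bellman:
  "(\<Sum>s'\<in>UNIV. visitation \<gamma> P \<pi> s s' * y s')
    = (1 - \<gamma>) * y s + \<gamma> * (\<Sum>t\<in>UNIV. induced P \<pi> s t * (\<Sum>s'\<in>UNIV. visitation \<gamma> P \<pi> t s' * y s'))"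
proof -
  have "(\<Sum>s'\<in>UNIV. visitation \<gamma> P \<pi> s s' * y s')
      = (\<Sum>s'\<in>UNIV. (1 - \<gamma>) * (of_bool (s = s') * y s'))
        + \<gamma> * (\<Sum>s'\<in>UNIV. \<Sum>t\<in>UNIV. induced P \<pi> s t * (visitation \<gamma> P \<pi> t s' * y s'))"
    by (subst visitation_bellman)
      (simp add: distrib_right sum.distrib sum_distrib_left sum_distrib_right mult.assoc)
  also have "(\<Sum>s'\<in>UNIV. (1 - \<gamma>) * (of_bool (s = s') * y s')) = (\<Sum>s'\<in>UNIV. if s = s' then (1 - \<gamma>) * y s' else 0)"
    by (intro sum.cong) auto
  also have "\<dots> = (1 - \<gamma>) * y s"
    by simp
  also have "(\<Sum>s'\<in>UNIV. \<Sum>t\<in>UNIV. induced P \<pi> s t * (visitation \<gamma> P \<pi> t s' * y s'))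
      = (\<Sum>t\<in>UNIV. induced P \<pi> s t * (\<Sum>s'\<in>UNIV. visitation \<gamma> P \<pi> t s' * y s'))"
    by (subst sum.swap) (simp add: sum_distrib_left)
  finally show ?thesis .
qed

text \<open>The visitation average of \<open>y\<close> solves the recursion with equality and source
  \<open>(1 - \<gamma>) * y\<close>. After scaling, the difference of the two sides obeys the
  maximum principle. This turns one-step inequalities into performance difference bounds.\<close>

lemma bellman_ineq_le_visitation:
  assumes "\<And>s. x s \<le> y s + \<gamma> * (\<Sum>t\<in>UNIV. induced P \<pi> s t * x t)"
  shows "(1 - \<gamma>) * x s \<le> (\<Sum>s'\<in>UNIV. visitation \<gamma> P \<pi> s s' * y s')"
proof -
  let ?z = "\<lambda>s. \<Sum>s'\<in>UNIV. visitation \<gamma> P \<pi> s s' * y s'"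
  have "(1 - \<gamma>) * x s - ?z s \<le> 0"
  proof (rule induced_max_principle[OF P \<pi> \<gamma>, where x="\<lambda>s. (1 - \<gamma>) * x s - ?z s"])
    fix s
    let ?X = "\<Sum>t\<in>UNIV. induced P \<pi> s t * x t" and ?Z = "\<Sum>t\<in>UNIV. induced P \<pi> s t * ?z t"
    have "(1 - \<gamma>) * x s \<le> (1 - \<gamma>) * (y s + \<gamma> * ?X)"
      using assms[of s] \<gamma> by (intro mult_left_mono) simp_all
    also have "\<dots> = (1 - \<gamma>) * y s + \<gamma> * ((1 - \<gamma>) * ?X)"
      by (simp only: distrib_left mult.left_commute)
    finally have "(1 - \<gamma>) * x s - ?z s \<le> \<gamma> * ((1 - \<gamma>) * ?X) - \<gamma> * ?Z"
      using visitation_sum_bellman[of s y] by linarith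
    also have "\<dots> = \<gamma> * ((1 - \<gamma>) * ?X - ?Z)"
      by (rule right_diff_distrib[symmetric])
    also have "(1 - \<gamma>) * ?X - ?Z = (\<Sum>t\<in>UNIV. induced P \<pi> s t * ((1 - \<gamma>) * x t - ?z t))"
      unfolding sum_distrib_left[of "1 - \<gamma>"] sum_subtractf[symmetric]
      by (intro sum.cong refl) (simp only: right_diff_distrib mult.left_commute)
    finally show "(1 - \<gamma>) * x s - ?z s
        \<le> \<gamma> * (\<Sum>t\<in>UNIV. induced P \<pi> s t * ((1 - \<gamma>) * x t - ?z t))" .
  qed
  then show ?thesis by simp
qed

text \<open>The deficit \<open>1 - ?z s\<close> solves the homogeneous recursion, so the maximum
  principle applies to it and to its negative.\<close>

lemma sum_visitation: "(\<Sum>s'\<in>UNIV. visitation \<gamma> P \<pi> s s') = 1"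
proof -
  let ?z = "\<lambda>s. \<Sum>s'\<in>UNIV. visitation \<gamma> P \<pi> s s'"
  have eq: "1 - ?z s = \<gamma> * (\<Sum>t\<in>UNIV. induced P \<pi> s t * (1 - ?z t))" for s
    using visitation_sum_bellman[of s "\<lambda>_. 1"]
    by (simp add: right_diff_distrib sum_subtractf sum_induced_1[OF P \<pi>])
  have "1 - ?z s \<le> 0"
    by (rule induced_max_principle[OF P \<pi> \<gamma>, where x="\<lambda>s. 1 - ?z s"]) (simp add: eq[symmetric])
  moreover have "?z s - 1 \<le> 0"
  proof (rule induced_max_principle[OF P \<pi> \<gamma>, where x="\<lambda>s. ?z s - 1"])
    fix s
    have "(\<Sum>t\<in>UNIV. induced P \<pi> s t * (?z t - 1)) = - (\<Sum>t\<in>UNIV. induced P \<pi> s t * (1 - ?z t))"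
      by (simp add: sum_negf[symmetric] algebra_simps)
    then show "?z s - 1 \<le> \<gamma> * (\<Sum>t\<in>UNIV. induced P \<pi> s t * (?z t - 1))"
      using eq[of s] by simp
  qed
  ultimately show ?thesis by simp
qed

end

section \<open>Robust Bellman equation and performance differences\<close>

context robust_mdp
begin

lemma discount_nonneg: "0 \<le> \<gamma>"
  using discount by simp

text \<open>Makes the family of values bounded above, without which the real \<open>SUP\<close> in
  \<open>V_rob\<close> would carry no information. It is the comparison lemma with source 1.\<close>

lemma V_val_le:
  assumes "u \<in> U" "\<pi> \<in> policies"
  shows "V_val c \<gamma> (PN + u) \<pi> s \<le> 1 / (1 - \<gamma>)"
proof -
  note P = U_kernels[OF assms(1)]
  let ?V = "V_val c \<gamma> (PN + u) \<pi>"
  have "(1 - \<gamma>) * ?V s \<le> (\<Sum>s'\<in>UNIV. visitation \<gamma> (PN + u) \<pi> s s' * 1)"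
  proof (rule bellman_ineq_le_visitation[OF discount_nonneg discount(2) P assms(2)])
    fix s
    have "?V s = (\<Sum>a\<in>UNIV. \<pi> $ s $ a * c s a) + \<gamma> * (\<Sum>t\<in>UNIV. induced (PN + u) \<pi> s t * ?V t)"
      unfolding sum_induced V_val_eq_Q_val[OF discount_nonneg discount(2) assms(2), of _ _ s]
        Q_val_bellman[OF discount_nonneg discount(2) P]
      by (simp only: sum_distrib_left distrib_left sum.distrib mult.left_commute)
    moreover have "(\<Sum>a\<in>UNIV. \<pi> $ s $ a * c s a) \<le> (\<Sum>a\<in>UNIV. \<pi> $ s $ a)"
      using assms(2) by (intro sum_mono)
        (simp add: cost_le_1 less_imp_le[OF cost_pos] mult_left_le policies_def prob_simplex_def)
    ultimately show "?V s \<le> 1 + \<gamma> * (\<Sum>t\<in>UNIV. induced (PN + u) \<pi> s t * ?V t)"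
      using assms(2) by (simp add: policies_def prob_simplex_def)
  qed
  then show ?thesis
    using discount by (simp add: sum_visitation[OF discount_nonneg discount(2) P assms(2)] field_simps)
qed

text \<open>Each pair \<open>(s, a)\<close> has its own maximiser by compactness and continuity;
  rectangularity allows the rows to be glued into one member of \<open>U\<close>.\<close>

lemma ex_worst_kernel:
  "\<exists>u\<in>U. \<forall>u'\<in>U. \<forall>s a. (\<Sum>t\<in>UNIV. (PN + u') $ s $ a $ t * v t) \<le> (\<Sum>t\<in>UNIV. (PN + u) $ s $ a $ t * v t)"
proof -
  let ?F = "\<lambda>s a u. \<Sum>t\<in>UNIV. (PN + u) $ s $ a $ t * v t"
  define W where "W s a u \<longleftrightarrow> u \<in> U \<and> (\<forall>u'\<in>U. ?F s a u' \<le> ?F s a u)" for s a u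
  have "\<exists>u. W s a u" for s a
  proof -
    have "\<exists>u\<in>U. \<forall>u'\<in>U. ?F s a u' \<le> ?F s a u"
      by (rule continuous_attains_sup[OF U_compact U_nonempty]) (intro continuous_intros)
    then show ?thesis
      unfolding W_def by blast
  qed
  then obtain f where W: "W s a (f s a)" for s a
    by metis
  have f: "f s a \<in> U" "u' \<in> U \<Longrightarrow> ?F s a u' \<le> ?F s a (f s a)" for s a u'
    using W[of s a] unfolding W_def by blast+
  define u where "u = (\<chi> s a. f s a $ s $ a)"
  have u_f: "u $ s $ a = f s a $ s $ a" for s a
    by (simp add: u_def)
  have "u $ s $ a \<in> (\<lambda>v. v $ s $ a) ` U" for s a
    unfolding u_f by (rule imageI) (rule f(1))
  then have "u \<in> U"
    by (subst U_rectangular) blast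
  moreover have "(\<Sum>t\<in>UNIV. (PN + u') $ s $ a $ t * v t) \<le> (\<Sum>t\<in>UNIV. (PN + u) $ s $ a $ t * v t)"
    if "u' \<in> U" for u' s a
    using f(2)[OF that, of s a] by (simp add: u_f)
  ultimately show ?thesis
    by blast
qed

text \<open>\<open>V_rob\<close> is a supremum taken separately at each state, so no Bellman
  equation comes with its definition; it is recovered from one \<open>u\<close> that is worst for
  the next-state values. The last clause keeps the optimality of this \<open>u\<close> against all
  other kernels, for comparing different policies.\<close>

lemma robust_bellman:
  assumes \<pi>: "\<pi> \<in> policies"
  obtains u where "u \<in> U"
    "\<And>s. V_rob c \<gamma> PN U \<pi> s = V_val c \<gamma> (PN + u) \<pi> s"
    "\<And>s a. Q_rob c \<gamma> PN U \<pi> s a = Q_val c \<gamma> (PN + u) \<pi> s a"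
    "\<And>u' s a. u' \<in> U \<Longrightarrow>
      c s a + \<gamma> * (\<Sum>t\<in>UNIV. (PN + u') $ s $ a $ t * V_rob c \<gamma> PN U \<pi> t) \<le> Q_rob c \<gamma> PN U \<pi> s a"
proof -
  let ?R = "V_rob c \<gamma> PN U \<pi>"
  let ?V = "\<lambda>u. V_val c \<gamma> (PN + u) \<pi>"
  let ?Q = "\<lambda>u. Q_val c \<gamma> (PN + u) \<pi>"
  have V_le_R: "?V u s \<le> ?R s" if "u \<in> U" for u s
    unfolding V_rob_def using that V_val_le[OF _ \<pi>] by (intro cSUP_upper bdd_aboveI2)
  obtain u where u: "u \<in> U" and worst: "\<And>u' s a. u' \<in> U \<Longrightarrow>
      (\<Sum>t\<in>UNIV. (PN + u') $ s $ a $ t * ?R t) \<le> (\<Sum>t\<in>UNIV. (PN + u) $ s $ a $ t * ?R t)"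
    using ex_worst_kernel[of ?R] by auto
  let ?T = "\<lambda>s a. c s a + \<gamma> * (\<Sum>t\<in>UNIV. (PN + u) $ s $ a $ t * ?R t)"
  have Q_le_T: "?Q u' s a \<le> ?T s a" if "u' \<in> U" for u' s a
  proof -
    have "(\<Sum>t\<in>UNIV. (PN + u') $ s $ a $ t * ?V u' t) \<le> (\<Sum>t\<in>UNIV. (PN + u') $ s $ a $ t * ?R t)"
      using U_kernels[OF that] V_le_R[OF that]
      by (intro sum_mono mult_left_mono) (auto simp: kernels_def prob_simplex_def)
    also have "\<dots> \<le> (\<Sum>t\<in>UNIV. (PN + u) $ s $ a $ t * ?R t)"
      using worst[OF that] .
    finally show ?thesis
      using discount_nonneg
      by (simp add: Q_val_bellman[OF discount_nonneg discount(2) U_kernels[OF that]] mult_left_mono)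
  qed
  \<comment> \<open>Passing to the supremum leaves an upper bound in which only the fixed
    \<open>u\<close> occurs.\<close>
  have R_le: "?R s \<le> (\<Sum>a\<in>UNIV. \<pi> $ s $ a * ?T s a)" for s
    unfolding V_rob_def[of c \<gamma> PN U \<pi> s]
  proof (rule cSUP_least[OF U_nonempty])
    fix u' assume "u' \<in> U"
    then show "?V u' s \<le> (\<Sum>a\<in>UNIV. \<pi> $ s $ a * ?T s a)"
      unfolding V_val_eq_Q_val[OF discount_nonneg discount(2) \<pi>] using \<pi> Q_le_T
      by (intro sum_mono mult_left_mono) (auto simp: policies_def prob_simplex_def)
  qed
  \<comment> \<open>\<open>?V u\<close> satisfies with equality the recursion that bounds
    \<open>?R\<close> from above, so the maximum principle controls the difference.\<close>
  have "?R s - ?V u s \<le> 0" for s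
  proof (rule induced_max_principle[OF U_kernels[OF u] \<pi> discount_nonneg discount(2),
        where x="\<lambda>s. ?R s - ?V u s"])
    fix s
    have "?R s - ?V u s \<le> (\<Sum>a\<in>UNIV. \<pi> $ s $ a * (?T s a - ?Q u s a))"
      using R_le[of s] by (simp add: V_val_eq_Q_val[OF discount_nonneg discount(2) \<pi>]
          right_diff_distrib sum_subtractf)
    also have "\<dots> = \<gamma> * (\<Sum>t\<in>UNIV. induced (PN + u) \<pi> s t * (?R t - ?V u t))"
      unfolding sum_induced
      by (simp only: Q_val_bellman[OF discount_nonneg discount(2) U_kernels[OF u]]
          right_diff_distrib sum_subtractf sum_distrib_left mult.left_commute add_diff_cancel_left)
    finally show "?R s - ?V u s \<le> \<gamma> * (\<Sum>t\<in>UNIV. induced (PN + u) \<pi> s t * (?R t - ?V u t))" .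
  qed
  then have R: "?R s = ?V u s" for s
    using V_le_R[OF u, of s] by (meson antisym diff_le_0_iff_le)
  have T: "?T s a = ?Q u s a" for s a
    by (simp add: Q_val_bellman[OF discount_nonneg discount(2) U_kernels[OF u]] R)
  have Q: "Q_rob c \<gamma> PN U \<pi> s a = ?Q u s a" for s a
    unfolding Q_rob_def
  proof (rule cSup_eq_maximum)
    show "?Q u s a \<in> (\<lambda>u. ?Q u s a) ` U"
      using u by simp
    show "x \<le> ?Q u s a" if "x \<in> (\<lambda>u. ?Q u s a) ` U" for x
      using that Q_le_T unfolding T by auto
  qed
  show thesis
  proof (rule that[OF u R Q])
    fix u' s a assume "u' \<in> U"
    then show "c s a + \<gamma> * (\<Sum>t\<in>UNIV. (PN + u') $ s $ a $ t * ?R t) \<le> Q_rob c \<gamma> PN U \<pi> s a"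
      unfolding Q T[symmetric] using discount_nonneg worst
      by (intro add_left_mono mult_left_mono)
  qed
qed

abbreviation "robV \<equiv> V_rob c \<gamma> PN U"
abbreviation "robQ \<pi> s \<equiv> \<chi> a. Q_rob c \<gamma> PN U \<pi> s a"

lemma V_rob_eq_inner:
  assumes "\<pi> \<in> policies"
  shows "robV \<pi> s = inner (robQ \<pi> s) (\<pi> $ s)"
proof -
  obtain u where "\<And>s. robV \<pi> s = V_val c \<gamma> (PN + u) \<pi> s"
    "\<And>s a. Q_rob c \<gamma> PN U \<pi> s a = Q_val c \<gamma> (PN + u) \<pi> s a"
    using robust_bellman[OF assms] by metis
  then show ?thesis
    by (simp add: V_val_eq_Q_val[OF discount_nonneg discount(2) assms] inner_vec_def mult.commute)
qed

text \<open>Choosing \<open>u\<close> worst for \<open>\<pi>\<close> gives the Bellman equation for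
  \<open>\<pi>\<close> and only a lower bound for \<open>\<pi>'\<close>; the costs cancel in the
  difference. One \<open>u\<close> serves all states and all \<open>\<nu>\<close>, which is what
  averaging over states requires. Below, \<open>\<nu>\<close> is once the second policy and once the
  first.\<close>

lemma Q_rob_diff_le:
  assumes \<pi>: "\<pi> \<in> policies" and \<pi>': "\<pi>' \<in> policies"
  shows "\<exists>u\<in>U. \<forall>\<nu>\<in>policies. \<forall>s. inner (robQ \<pi> s - robQ \<pi>' s) (\<nu> $ s)
      \<le> \<gamma> * (\<Sum>t\<in>UNIV. induced (PN + u) \<nu> s t * (robV \<pi> t - robV \<pi>' t))"
proof -
  obtain u where u: "u \<in> U" and V: "\<And>s. robV \<pi> s = V_val c \<gamma> (PN + u) \<pi> s"
    and Q: "\<And>s a. Q_rob c \<gamma> PN U \<pi> s a = Q_val c \<gamma> (PN + u) \<pi> s a"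
    using robust_bellman[OF \<pi>] by metis
  have u': "c s a + \<gamma> * (\<Sum>t\<in>UNIV. (PN + u) $ s $ a $ t * robV \<pi>' t)
      \<le> Q_rob c \<gamma> PN U \<pi>' s a" for s a
    using robust_bellman[OF \<pi>'] u by metis
  have "inner (robQ \<pi> s - robQ \<pi>' s) (\<nu> $ s)
      \<le> \<gamma> * (\<Sum>t\<in>UNIV. induced (PN + u) \<nu> s t * (robV \<pi> t - robV \<pi>' t))"
    if \<nu>: "\<nu> \<in> policies" for \<nu> s
  proof -
    have "inner (robQ \<pi> s - robQ \<pi>' s) (\<nu> $ s)
        = (\<Sum>a\<in>UNIV. \<nu> $ s $ a * (Q_rob c \<gamma> PN U \<pi> s a - Q_rob c \<gamma> PN U \<pi>' s a))"
      by (simp add: inner_vec_def mult.commute)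
    also have "\<dots> \<le> (\<Sum>a\<in>UNIV. \<nu> $ s $ a *
        (\<gamma> * (\<Sum>t\<in>UNIV. (PN + u) $ s $ a $ t * (robV \<pi> t - robV \<pi>' t))))"
    proof (intro sum_mono mult_left_mono)
      fix a
      show "Q_rob c \<gamma> PN U \<pi> s a - Q_rob c \<gamma> PN U \<pi>' s a
          \<le> \<gamma> * (\<Sum>t\<in>UNIV. (PN + u) $ s $ a $ t * (robV \<pi> t - robV \<pi>' t))"
        using u'[of s a] unfolding Q V Q_val_bellman[OF discount_nonneg discount(2) U_kernels[OF u]]
        by (simp add: right_diff_distrib sum_subtractf del: vector_add_component)
      show "0 \<le> \<nu> $ s $ a"
        using \<nu> by (simp add: policies_def prob_simplex_def)
    qed
    also have "\<dots> = \<gamma> * (\<Sum>t\<in>UNIV. induced (PN + u) \<nu> s t * (robV \<pi> t - robV \<pi>' t))"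
      unfolding sum_induced by (simp only: sum_distrib_left mult.left_commute)
    finally show ?thesis .
  qed
  with u show ?thesis
    by blast
qed

text \<open>The value gap is \<open>inner (robQ \<pi> s) (\<pi> $ s - \<pi>' $ s)\<close> plus
  \<open>inner (robQ \<pi> s - robQ \<pi>' s) (\<pi>' $ s)\<close>. The second part is bounded by a
  discounted gap at the next state, and iteration yields the visitation measure of
  \<open>\<pi>'\<close>.\<close>

lemma V_rob_diff_le_visitation:
  assumes \<pi>: "\<pi> \<in> policies" and \<pi>': "\<pi>' \<in> policies"
  obtains u where "u \<in> U"
    "\<And>s. (1 - \<gamma>) * (robV \<pi> s - robV \<pi>' s)
      \<le> (\<Sum>t\<in>UNIV. visitation \<gamma> (PN + u) \<pi>' s t * inner (robQ \<pi> t) (\<pi> $ t - \<pi>' $ t))"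
proof -
  obtain u where u: "u \<in> U" and le: "\<forall>\<nu>\<in>policies. \<forall>s. inner (robQ \<pi> s - robQ \<pi>' s) (\<nu> $ s)
      \<le> \<gamma> * (\<Sum>t\<in>UNIV. induced (PN + u) \<nu> s t * (robV \<pi> t - robV \<pi>' t))"
    by (rule bexE[OF Q_rob_diff_le[OF \<pi> \<pi>']])
  have "robV \<pi> s - robV \<pi>' s \<le> inner (robQ \<pi> s) (\<pi> $ s - \<pi>' $ s)
      + \<gamma> * (\<Sum>t\<in>UNIV. induced (PN + u) \<pi>' s t * (robV \<pi> t - robV \<pi>' t))" for s
    using le[rule_format, OF \<pi>', of s] \<pi> \<pi>' by (simp only: V_rob_eq_inner inner_diff_left inner_diff_right)
  from bellman_ineq_le_visitation[OF discount_nonneg discount(2) U_kernels[OF u] \<pi>' this] u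
  show thesis
    by (intro that)
qed

lemma V_rob_improvement:
  assumes \<pi>: "\<pi> \<in> policies" and \<pi>': "\<pi>' \<in> policies"
    and le: "\<And>s. inner (robQ \<pi> s) (\<pi>' $ s - \<pi> $ s) \<le> 0"
  shows "robV \<pi>' s \<le> robV \<pi> s"
    and "robV \<pi>' s - robV \<pi> s \<le> inner (robQ \<pi> s) (\<pi>' $ s - \<pi> $ s)"
proof -
  obtain u where u: "u \<in> U" and Q: "\<forall>\<nu>\<in>policies. \<forall>s. inner (robQ \<pi>' s - robQ \<pi> s) (\<nu> $ s)
      \<le> \<gamma> * (\<Sum>t\<in>UNIV. induced (PN + u) \<nu> s t * (robV \<pi>' t - robV \<pi> t))"
    by (rule bexE[OF Q_rob_diff_le[OF \<pi>' \<pi>]])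
  note P = U_kernels[OF u]
  have V: "robV \<pi>' s - robV \<pi> s \<le> inner (robQ \<pi> s) (\<pi>' $ s - \<pi> $ s)
      + \<gamma> * (\<Sum>t\<in>UNIV. induced (PN + u) \<pi>' s t * (robV \<pi>' t - robV \<pi> t))" for s
    using Q[rule_format, OF \<pi>', of s] \<pi> \<pi>' by (simp only: V_rob_eq_inner inner_diff_left inner_diff_right)
  have le0: "robV \<pi>' s - robV \<pi> s \<le> 0" for s
  proof (rule induced_max_principle[OF P \<pi>' discount_nonneg discount(2),
        where x="\<lambda>s. robV \<pi>' s - robV \<pi> s"])
    show "robV \<pi>' s - robV \<pi> s
        \<le> \<gamma> * (\<Sum>t\<in>UNIV. induced (PN + u) \<pi>' s t * (robV \<pi>' t - robV \<pi> t))" for s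
      using V[of s] le[of s] by linarith
  qed
  then show "robV \<pi>' s \<le> robV \<pi> s"
    by simp
  have "\<gamma> * (\<Sum>t\<in>UNIV. induced (PN + u) \<pi>' s t * (robV \<pi>' t - robV \<pi> t)) \<le> 0"
    using discount_nonneg le0 induced_nonneg[OF P \<pi>']
    by (intro mult_nonneg_nonpos sum_nonpos)
  then show "robV \<pi>' s - robV \<pi> s \<le> inner (robQ \<pi> s) (\<pi>' $ s - \<pi> $ s)"
    using V[of s] by linarith
qed

end

section \<open>Mirror descent\<close>

lemma has_real_derivative_along_line:
  assumes "(w has_derivative D) (at q)"
  shows "((\<lambda>t::real. w (q + t *\<^sub>R v) :: real) has_real_derivative D v) (at 0)"
proof -
  interpret D: bounded_linear D
    using assms by (rule has_derivative_bounded_linear)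
  have "((\<lambda>t::real. q + t *\<^sub>R v) has_derivative (\<lambda>t. t *\<^sub>R v)) (at 0)"
    by (auto intro!: derivative_eq_intros)
  then have "((\<lambda>t::real. w (q + t *\<^sub>R v)) has_derivative (\<lambda>t. D (t *\<^sub>R v))) (at 0)"
    by (rule has_derivative_compose) (use assms in simp)
  then show ?thesis
    by (simp add: has_field_derivative_def D.scaleR mult_commute_abs)
qed

text \<open>The subgradient inequality makes 0 a minimum of \<open>?f\<close>, so its derivative
  there vanishes.\<close>

lemma subgradient_eq_derivative:
  assumes "subgradient w q g" "(w has_derivative D) (at q)"
  shows "D v = inner g v"
proof -
  let ?f = "\<lambda>t::real. w (q + t *\<^sub>R v) - t * inner g v"
  have "(?f has_real_derivative D v - inner g v) (at 0)"
    using has_real_derivative_along_line[OF assms(2), of v] by (auto intro!: derivative_eq_intros)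
  moreover have "?f 0 \<le> ?f t" for t
    using assms(1)[unfolded subgradient_def, rule_format, of "q + t *\<^sub>R v"] by simp
  ultimately have "D v - inner g v = 0"
    using DERIV_local_min[of ?f "D v - inner g v" 0 1] by simp
  then show ?thesis by simp
qed

lemma prob_simplex_segment:
  assumes "p \<in> prob_simplex" "q \<in> prob_simplex" "0 \<le> t" "t \<le> 1"
  shows "q + t *\<^sub>R (p - q) \<in> prob_simplex"
proof -
  have "q $ i + t * (p $ i - q $ i) = (1 - t) * q $ i + t * p $ i" for i
    by (simp add: algebra_simps)
  with assms show ?thesis
    by (simp add: prob_simplex_def sum.distrib sum_distrib_left[symmetric])
qed

text \<open>A negative derivative of the objective along the segment from \<open>q\<close> to
  \<open>p\<close> would contradict minimality; differentiability identifies the derivative of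
  \<open>w\<close> at \<open>q\<close> with \<open>g'\<close>.\<close>

lemma arg_min_first_order:
  fixes w :: "real ^ 'a::finite \<Rightarrow> real"
  assumes min: "is_arg_min (\<lambda>p. \<eta> * inner Q p + bregman w g p p0) (\<lambda>p. p \<in> prob_simplex) q"
    and diff: "w differentiable (at q)" and sub: "subgradient w q g'" and p: "p \<in> prob_simplex"
  shows "0 \<le> inner (\<eta> *\<^sub>R Q + g' - g) (p - q)"
proof (rule ccontr)
  obtain D where D: "(w has_derivative D) (at q)"
    using diff by (auto simp: differentiable_def)
  let ?v = "p - q"
  let ?f = "\<lambda>t::real. \<eta> * inner Q (q + t *\<^sub>R ?v) + bregman w g (q + t *\<^sub>R ?v) p0"
  let ?l = "inner (\<eta> *\<^sub>R Q + g' - g) ?v"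
  have "?f = (\<lambda>t. \<eta> * (inner Q q + t * inner Q ?v)
      + (w (q + t *\<^sub>R ?v) - w p0 - (inner g (q - p0) + t * inner g ?v)))"
    by (simp add: bregman_def inner_add_right inner_diff_right algebra_simps)
  moreover have "((\<lambda>t. \<eta> * (inner Q q + t * inner Q ?v)
      + (w (q + t *\<^sub>R ?v) - w p0 - (inner g (q - p0) + t * inner g ?v)))
      has_real_derivative (\<eta> * inner Q ?v + (D ?v - inner g ?v))) (at 0)"
    using has_real_derivative_along_line[OF D, of ?v] by (auto intro!: derivative_eq_intros)
  moreover have "\<eta> * inner Q ?v + (D ?v - inner g ?v) = ?l"
    by (simp add: subgradient_eq_derivative[OF sub D] inner_add_left inner_diff_left)
  ultimately have "(?f has_real_derivative ?l) (at 0)"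
    by simp
  moreover assume "\<not> 0 \<le> ?l"
  ultimately obtain d where d: "0 < d" "\<And>h. 0 < h \<Longrightarrow> h < d \<Longrightarrow> ?f (0 + h) < ?f 0"
    using DERIV_neg_dec_right[of ?f ?l 0] by (meson not_le)
  \<comment> \<open>Small enough for the strict decrease, and at most 1 so that the point stays on
    the segment inside the simplex.\<close>
  define h where "h = min (d / 2) 1"
  have h: "0 < h" "h < d" "h \<le> 1"
    using d(1) by (auto simp: h_def min_def)
  have q: "q \<in> prob_simplex"
    using min by (simp add: is_arg_min_def)
  have "?f 0 \<le> ?f h"
    using min prob_simplex_segment[OF p q, of h] h by (simp add: is_arg_min_linorder)
  then show False
    using d(2)[OF h(1,2)] by simp
qed

text \<open>All values of \<open>w\<close> cancel, so the identity holds for arbitrary vectors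
  \<open>g\<close> and \<open>g'\<close>.\<close>

lemma bregman_three_point:
  "bregman w g p p0 - bregman w g q p0 - bregman w g' p q = inner (g' - g) (p - q)"
  by (simp add: bregman_def inner_diff_left inner_diff_right)

lemma bregman_nonneg: "subgradient w q g \<Longrightarrow> 0 \<le> bregman w g p q"
  unfolding subgradient_def bregman_def by (metis diff_ge_0_iff_ge le_diff_eq add.commute diff_diff_eq)

lemma rpmd_policies:
  assumes "rpmd c \<gamma> PN U w \<eta> g \<pi>"
  shows "\<pi> k \<in> policies"
proof (cases k)
  case 0
  then show ?thesis using assms by (simp add: rpmd_def)
next
  case (Suc j)
  then show ?thesis using assms by (auto simp: rpmd_def policies_def is_arg_min_def)
qed

lemma rpmd_three_point:
  assumes rpmd: "rpmd c \<gamma> PN U w \<eta> g \<pi>" and p: "p \<in> prob_simplex"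
  shows "\<eta> k * inner (\<chi> a. Q_rob c \<gamma> PN U (\<pi> k) s a) (\<pi> (Suc k) $ s - p)
      + bregman w (g k $ s) (\<pi> (Suc k) $ s) (\<pi> k $ s)
      + bregman w (g (Suc k) $ s) p (\<pi> (Suc k) $ s)
    \<le> bregman w (g k $ s) p (\<pi> k $ s)"
proof -
  let ?Q = "\<chi> a. Q_rob c \<gamma> PN U (\<pi> k) s a"
  have "0 \<le> inner (\<eta> k *\<^sub>R ?Q + g (Suc k) $ s - g k $ s) (p - \<pi> (Suc k) $ s)"
  \<comment> \<open>Where \<open>w\<close> is differentiable the optimality condition follows from
    minimality; elsewhere it is a clause of \<open>rpmd\<close>.\<close>
  proof (cases "w differentiable (at (\<pi> (Suc k) $ s))")
    case True
    with rpmd p show ?thesis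
      by (intro arg_min_first_order) (auto simp: rpmd_def)
  next
    case False
    with rpmd p show ?thesis
      unfolding rpmd_def by blast
  qed
  also have "\<dots> = \<eta> k * inner ?Q (p - \<pi> (Suc k) $ s) + inner (g (Suc k) $ s - g k $ s) (p - \<pi> (Suc k) $ s)"
    by (simp only: inner_add_left inner_diff_left inner_scaleR_left add_diff_eq)
  finally show ?thesis
    using bregman_three_point[of w "g k $ s" p "\<pi> k $ s" "\<pi> (Suc k) $ s" "g (Suc k) $ s"]
    by (simp add: inner_diff_right right_diff_distrib)
qed

section \<open>Entrywise ratios of measures\<close>

lemma ratio_norm_bound:
  assumes "ratio_norm \<mu> \<nu> \<le> K" "K < \<infinity>" "0 \<le> \<mu> s" "0 \<le> \<nu> s"
  shows "\<mu> s \<le> enn2real K * \<nu> s"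
proof -
  have le: "ennreal (\<mu> s) / ennreal (\<nu> s) \<le> ennreal (enn2real K)"
    using assms(1,2) unfolding ratio_norm_def by (simp add: SUP_le_iff)
  show ?thesis
  proof (cases "\<nu> s = 0")
    \<comment> \<open>Here the ratio is infinite unless \<open>\<mu> s = 0\<close>, so finiteness of
      \<open>K\<close> forces absolute continuity.\<close>
    case True
    show ?thesis
    proof (rule ccontr)
      assume "\<not> ?thesis"
      then have "0 < \<mu> s" using True by simp
      then show False using le True by (simp add: ennreal_divide_eq_top_iff top_unique)
    qed
  next
    case False
    then have "0 < \<nu> s" using assms(4) by simp
    then show ?thesis
      using le assms(3) by (simp add: divide_ennreal divide_le_eq)
  qed
qed

lemma ratio_norm_le:
  assumes "\<And>s. \<mu> s \<le> 1" "\<And>s. 0 \<le> \<mu> s" "0 < e" "\<And>s. e \<le> \<nu> s"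
  shows "ratio_norm \<mu> \<nu> \<le> ennreal (1 / e)"
  unfolding ratio_norm_def
proof (rule SUP_least)
  fix s
  have "0 < \<nu> s" using assms(3) assms(4)[of s] by simp
  then show "ennreal (\<mu> s) / ennreal (\<nu> s) \<le> ennreal (1 / e)"
    using assms by (simp add: divide_ennreal frac_le)
qed

text \<open>The potential on the left contracts by \<open>\<alpha>\<close> per iteration.
  \<open>X k\<close> stands for the divergence averaged over the current visitation measure,
  \<open>Y k\<close> for the next divergence averaged over the same measure. The first step carries
  \<open>X 0 / (m * \<eta> 0)\<close> without a factor \<open>\<alpha>\<close>, whence the exponent
  \<open>k - 1\<close> in the rate.\<close>

lemma mirror_descent_recursion:
  fixes \<delta> X Y \<eta> :: "nat \<Rightarrow> real"
  assumes m: "0 < m" "0 < m'" and \<alpha>: "0 < \<alpha>" "\<alpha> = 1 - (1 - \<gamma>) / m" and \<eta>: "\<And>k. 0 < \<eta> k"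
    and step: "\<And>k. \<eta> k * (m * (\<delta> (Suc k) - \<delta> k) + (1 - \<gamma>) * \<delta> k) + Y k \<le> X k"
    and X: "\<And>k. 0 \<le> X k" "\<And>k. X (Suc k) \<le> m' * Y k"
    and growth: "\<And>k. \<eta> k * inverse \<alpha> * m' \<le> \<eta> (Suc k)"
  shows "\<delta> (Suc k) + X (Suc k) / (m * \<eta> k * m') \<le> \<alpha> ^ k * (\<alpha> * \<delta> 0 + X 0 / (m * \<eta> 0))"
proof -
  have one: "\<delta> (Suc k) + X (Suc k) / (m * \<eta> k * m') \<le> \<alpha> * \<delta> k + X k / (m * \<eta> k)" for k
  proof -
    have "m * \<alpha> = m - (1 - \<gamma>)"
      using m \<alpha>(2) by (simp add: field_simps)
    then have "m * \<eta> k * \<alpha> = \<eta> k * (m - (1 - \<gamma>))"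
      by (metis mult.assoc mult.commute)
    then have rhs: "m * \<eta> k * (\<alpha> * \<delta> k + X k / (m * \<eta> k)) = \<eta> k * (m - (1 - \<gamma>)) * \<delta> k + X k"
      using m \<eta>[of k] by (simp add: distrib_left)
    have lhs: "m * \<eta> k * (\<delta> (Suc k) + X (Suc k) / (m * \<eta> k * m'))
        = m * \<eta> k * \<delta> (Suc k) + X (Suc k) / m'"
      using m \<eta>[of k] by (simp add: distrib_left)
    have "X (Suc k) / m' \<le> Y k"
      using m X(2)[of k] by (simp add: field_simps)
    then have "m * \<eta> k * (\<delta> (Suc k) + X (Suc k) / (m * \<eta> k * m'))
        \<le> m * \<eta> k * (\<alpha> * \<delta> k + X k / (m * \<eta> k))"
      unfolding lhs rhs using step[of k] by (simp add: algebra_simps)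
    then show ?thesis
      using m \<eta>[of k] by simp
  qed
  show ?thesis
  proof (induction k)
    case 0
    show ?case using one[of 0] by simp
  next
    case (Suc k)
    \<comment> \<open>Growth of the stepsizes supplies the factor \<open>\<alpha>\<close> on the
      divergence term and pays for the change of measure by \<open>m'\<close>.\<close>
    have "X (Suc k) / (m * \<eta> (Suc k)) \<le> X (Suc k) / (m * (\<eta> k * inverse \<alpha> * m'))"
      using growth[of k] m \<alpha>(1) \<eta>[of k] \<eta>[of "Suc k"] X(1)
      by (intro divide_left_mono mult_left_mono mult_pos_pos) simp_all
    also have "\<dots> = \<alpha> * (X (Suc k) / (m * \<eta> k * m'))"
      using \<alpha>(1) by (simp add: field_simps)
    finally have "\<delta> (Suc (Suc k)) + X (Suc (Suc k)) / (m * \<eta> (Suc k) * m')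
        \<le> \<alpha> * (\<delta> (Suc k) + X (Suc k) / (m * \<eta> k * m'))"
      using one[of "Suc k"] by (simp add: distrib_left)
    also have "\<dots> \<le> \<alpha> * (\<alpha> ^ k * (\<alpha> * \<delta> 0 + X 0 / (m * \<eta> 0)))"
      using Suc \<alpha>(1) by (intro mult_left_mono) simp_all
    finally show ?case by (simp add: mult.assoc)
  qed
qed

section \<open>Convergence of RPMD\<close>

context robust_mdp
begin

lemma visitation_avg_nonneg:
  assumes "u \<in> U" "\<pi> \<in> policies" "\<rho> \<in> prob_simplex"
  shows "0 \<le> visitation_avg \<gamma> (PN + u) \<pi> \<rho> s"
  unfolding visitation_avg_def
  using assms(3) visitation_nonneg[OF discount_nonneg discount(2) U_kernels[OF assms(1)] assms(2)]
  by (intro sum_nonneg mult_nonneg_nonneg) (auto simp: prob_simplex_def)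

lemma sum_visitation_avg_mult:
  "(\<Sum>t\<in>UNIV. visitation_avg \<gamma> P \<pi> \<rho> t * y t)
    = (\<Sum>s\<in>UNIV. \<rho> $ s * (\<Sum>t\<in>UNIV. visitation \<gamma> P \<pi> s t * y t))"
  unfolding visitation_avg_def sum_distrib_left sum_distrib_right
  by (subst sum.swap) (simp only: mult.assoc)

lemma sum_visitation_avg:
  assumes "u \<in> U" "\<pi> \<in> policies" "\<rho> \<in> prob_simplex"
  shows "(\<Sum>t\<in>UNIV. visitation_avg \<gamma> (PN + u) \<pi> \<rho> t) = 1"
  using sum_visitation_avg_mult[of "PN + u" \<pi> \<rho> "\<lambda>_. 1"] assms(3)
  by (simp add: sum_visitation[OF discount_nonneg discount(2) U_kernels[OF assms(1)] assms(2)]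
      prob_simplex_def)

lemma visitation_avg_le_1:
  assumes "u \<in> U" "\<pi> \<in> policies" "\<rho> \<in> prob_simplex"
  shows "visitation_avg \<gamma> (PN + u) \<pi> \<rho> s \<le> 1"
  using member_le_sum[of s UNIV "visitation_avg \<gamma> (PN + u) \<pi> \<rho>"] visitation_avg_nonneg[OF assms]
  by (simp add: sum_visitation_avg[OF assms])

text \<open>The starting state alone contributes this mass, uniformly in \<open>u\<close>, so a
  \<open>\<rho>\<close> of full support bounds all visitation measures away from 0.\<close>

lemma visitation_avg_ge:
  assumes "u \<in> U" "\<pi> \<in> policies" "\<rho> \<in> prob_simplex"
  shows "(1 - \<gamma>) * \<rho> $ s \<le> visitation_avg \<gamma> (PN + u) \<pi> \<rho> s"
proof -
  note vis = discount_nonneg discount(2) U_kernels[OF assms(1)] assms(2)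
  have \<rho>: "0 \<le> \<rho> $ t" for t
    using assms(3) by (simp add: prob_simplex_def)
  have "(1 - \<gamma>) * \<rho> $ s \<le> \<rho> $ s * visitation \<gamma> (PN + u) \<pi> s s"
    using mult_left_mono[OF visitation_self_ge[OF vis] \<rho>] by (simp add: mult.commute)
  also have "\<dots> \<le> visitation_avg \<gamma> (PN + u) \<pi> \<rho> s"
    unfolding visitation_avg_def using \<rho> visitation_nonneg[OF vis]
    by (intro member_le_sum[where f="\<lambda>t. \<rho> $ t * visitation \<gamma> (PN + u) \<pi> t s"]) simp_all
  finally show ?thesis .
qed

lemma objective_diff_le_visitation_avg:
  assumes "\<pi> \<in> policies" "\<pi>' \<in> policies" "\<rho> \<in> prob_simplex"
  shows "\<exists>u\<in>U. (1 - \<gamma>) * (objective c \<gamma> PN U \<rho> \<pi> - objective c \<gamma> PN U \<rho> \<pi>')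
    \<le> (\<Sum>t\<in>UNIV. visitation_avg \<gamma> (PN + u) \<pi>' \<rho> t * inner (robQ \<pi> t) (\<pi> $ t - \<pi>' $ t))"
proof -
  obtain u where u: "u \<in> U"
    and le: "\<And>s. (1 - \<gamma>) * (robV \<pi> s - robV \<pi>' s)
      \<le> (\<Sum>t\<in>UNIV. visitation \<gamma> (PN + u) \<pi>' s t * inner (robQ \<pi> t) (\<pi> $ t - \<pi>' $ t))"
    by (rule V_rob_diff_le_visitation[OF assms(1,2)]) blast
  have "(1 - \<gamma>) * (objective c \<gamma> PN U \<rho> \<pi> - objective c \<gamma> PN U \<rho> \<pi>')
      = (\<Sum>s\<in>UNIV. \<rho> $ s * ((1 - \<gamma>) * (robV \<pi> s - robV \<pi>' s)))"
    unfolding objective_def sum_subtractf[symmetric] sum_distrib_left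
    by (simp only: right_diff_distrib[symmetric] mult.left_commute)
  also have "\<dots> \<le> (\<Sum>s\<in>UNIV. \<rho> $ s *
      (\<Sum>t\<in>UNIV. visitation \<gamma> (PN + u) \<pi>' s t * inner (robQ \<pi> t) (\<pi> $ t - \<pi>' $ t)))"
    using assms(3) by (intro sum_mono mult_left_mono le) (simp add: prob_simplex_def)
  finally show ?thesis
    using u unfolding sum_visitation_avg_mult by blast
qed

lemma mismatch_finite:
  assumes \<rho>: "\<rho> \<in> prob_simplex" and pos: "\<And>s. 0 < \<rho> $ s" and \<pi>: "\<pi> \<in> policies"
  shows "(SUP u\<in>U. ratio_norm (visitation_avg \<gamma> (PN + u) \<pi> \<rho>) (($) \<rho>)) < \<infinity>"
    and "(SUP u\<in>U. SUP u'\<in>U. ratio_norm (visitation_avg \<gamma> (PN + u) \<pi> \<rho>)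
           (visitation_avg \<gamma> (PN + u') \<pi> \<rho>)) < \<infinity>"
proof -
  \<comment> \<open>A common lower bound for \<open>\<rho>\<close> and every averaged visitation
    measure; as the numerators are at most 1, \<open>1 / e\<close> bounds both suprema.\<close>
  define e where "e = (1 - \<gamma>) * Min (range (($) \<rho>))"
  have "Min (range (($) \<rho>)) \<in> range (($) \<rho>)"
    by simp
  then have min: "0 < Min (range (($) \<rho>))"
    using pos by (metis imageE)
  then have e: "0 < e"
    using discount by (simp add: e_def)
  have e\<rho>: "e \<le> (1 - \<gamma>) * \<rho> $ s" for s
    unfolding e_def using discount by (intro mult_left_mono) simp_all
  have ed: "e \<le> visitation_avg \<gamma> (PN + u) \<pi> \<rho> s" if "u \<in> U" for u s
    using e\<rho>[of s] visitation_avg_ge[OF that \<pi> \<rho>, of s] by linarith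
  have "(1 - \<gamma>) * \<rho> $ s \<le> \<rho> $ s" for s
    using discount pos[of s] by (simp add: mult_left_le_one_le)
  then have e\<rho>': "e \<le> \<rho> $ s" for s
    using e\<rho>[of s] by (meson order_trans)
  have "(SUP u\<in>U. ratio_norm (visitation_avg \<gamma> (PN + u) \<pi> \<rho>) (($) \<rho>)) \<le> ennreal (1 / e)"
    using visitation_avg_le_1[OF _ \<pi> \<rho>] visitation_avg_nonneg[OF _ \<pi> \<rho>] e e\<rho>'
    by (intro SUP_least ratio_norm_le)
  then show "(SUP u\<in>U. ratio_norm (visitation_avg \<gamma> (PN + u) \<pi> \<rho>) (($) \<rho>)) < \<infinity>"
    by (simp add: le_less_trans)
  have "(SUP u\<in>U. SUP u'\<in>U. ratio_norm (visitation_avg \<gamma> (PN + u) \<pi> \<rho>)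
      (visitation_avg \<gamma> (PN + u') \<pi> \<rho>)) \<le> ennreal (1 / e)"
    using visitation_avg_le_1[OF _ \<pi> \<rho>] visitation_avg_nonneg[OF _ \<pi> \<rho>] e ed
    by (intro SUP_least ratio_norm_le)
  then show "(SUP u\<in>U. SUP u'\<in>U. ratio_norm (visitation_avg \<gamma> (PN + u) \<pi> \<rho>)
      (visitation_avg \<gamma> (PN + u') \<pi> \<rho>)) < \<infinity>"
    by (simp add: le_less_trans)
qed

text \<open>The kernel \<open>u\<close> comes from the gap between \<open>\<pi> k\<close> and the
  comparator \<open>\<nu>\<close>, and the same averaged measure weights both divergences.\<close>

lemma rpmd_step:
  fixes m :: real
  assumes rpmd: "rpmd c \<gamma> PN U w \<eta> g \<pi>" and \<eta>: "0 < \<eta> k" and \<nu>: "\<nu> \<in> policies"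
    and \<rho>: "\<rho> \<in> prob_simplex"
    and m: "\<And>u s. u \<in> U \<Longrightarrow> visitation_avg \<gamma> (PN + u) \<nu> \<rho> s \<le> m * \<rho> $ s"
  shows "\<exists>u\<in>U. \<eta> k * (m * (objective c \<gamma> PN U \<rho> (\<pi> (Suc k)) - objective c \<gamma> PN U \<rho> (\<pi> k))
        + (1 - \<gamma>) * (objective c \<gamma> PN U \<rho> (\<pi> k) - objective c \<gamma> PN U \<rho> \<nu>))
      + (\<Sum>s\<in>UNIV. visitation_avg \<gamma> (PN + u) \<nu> \<rho> s * bregman w (g (Suc k) $ s) (\<nu> $ s) (\<pi> (Suc k) $ s))
    \<le> (\<Sum>s\<in>UNIV. visitation_avg \<gamma> (PN + u) \<nu> \<rho> s * bregman w (g k $ s) (\<nu> $ s) (\<pi> k $ s))"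
proof -
  let ?f = "objective c \<gamma> PN U \<rho>"
  let ?D = "\<lambda>k s. bregman w (g k $ s) (\<nu> $ s) (\<pi> k $ s)"
  note \<pi> = rpmd_policies[OF rpmd]
  have sub: "subgradient w (\<pi> j $ s) (g j $ s)" for j s
    using rpmd by (simp add: rpmd_def)
  have three: "\<eta> k * inner (robQ (\<pi> k) s) (\<pi> (Suc k) $ s - p) + bregman w (g (Suc k) $ s) p (\<pi> (Suc k) $ s)
      \<le> bregman w (g k $ s) p (\<pi> k $ s)" if "p \<in> prob_simplex" for p s
    using rpmd_three_point[OF rpmd that, of k s] bregman_nonneg[OF sub[of k s], of "\<pi> (Suc k) $ s"] by linarith
  \<comment> \<open>Compares the update with the current iterate, whose divergence from itself is
    zero.\<close>
  have descent: "inner (robQ (\<pi> k) s) (\<pi> (Suc k) $ s - \<pi> k $ s) \<le> 0" for s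
  proof -
    have "\<eta> k * inner (robQ (\<pi> k) s) (\<pi> (Suc k) $ s - \<pi> k $ s) \<le> 0"
      using three[of "\<pi> k $ s" s] \<pi>[of k] bregman_nonneg[OF sub[of "Suc k" s], of "\<pi> k $ s"]
      by (simp add: policies_def bregman_def)
    then show ?thesis
      using \<eta> by (simp add: mult_le_0_iff)
  qed
  obtain u where u: "u \<in> U" and gap: "(1 - \<gamma>) * (?f (\<pi> k) - ?f \<nu>)
      \<le> (\<Sum>t\<in>UNIV. visitation_avg \<gamma> (PN + u) \<nu> \<rho> t * inner (robQ (\<pi> k) t) (\<pi> k $ t - \<nu> $ t))"
    using objective_diff_le_visitation_avg[OF \<pi>[of k] \<nu> \<rho>] by blast
  let ?d = "visitation_avg \<gamma> (PN + u) \<nu> \<rho>"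
  note d = visitation_avg_nonneg[OF u \<nu> \<rho>]
  have "m * (?f (\<pi> (Suc k)) - ?f (\<pi> k))
      = (\<Sum>s\<in>UNIV. (m * \<rho> $ s) * (robV (\<pi> (Suc k)) s - robV (\<pi> k) s))"
    unfolding objective_def sum_subtractf[symmetric] sum_distrib_left
    by (simp only: right_diff_distrib[symmetric] mult.assoc)
  \<comment> \<open>The value differences are nonpositive, so replacing the weight
    \<open>m * \<rho> $ s\<close> by the smaller visitation weight does not decrease the
    sum.\<close>
  also have "\<dots> \<le> (\<Sum>s\<in>UNIV. ?d s * (robV (\<pi> (Suc k)) s - robV (\<pi> k) s))"
    using V_rob_improvement(1)[OF \<pi> \<pi> descent] m[OF u]
    by (intro sum_mono mult_right_mono_neg) simp_all
  also have "\<dots> \<le> (\<Sum>s\<in>UNIV. ?d s * inner (robQ (\<pi> k) s) (\<pi> (Suc k) $ s - \<pi> k $ s))"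
    using V_rob_improvement(2)[OF \<pi> \<pi> descent] d by (intro sum_mono mult_left_mono)
  finally have "m * (?f (\<pi> (Suc k)) - ?f (\<pi> k)) + (1 - \<gamma>) * (?f (\<pi> k) - ?f \<nu>)
      \<le> (\<Sum>s\<in>UNIV. ?d s * inner (robQ (\<pi> k) s) (\<pi> (Suc k) $ s - \<pi> k $ s))
        + (\<Sum>s\<in>UNIV. ?d s * inner (robQ (\<pi> k) s) (\<pi> k $ s - \<nu> $ s))"
    using gap by linarith
  also have "\<dots> = (\<Sum>s\<in>UNIV. ?d s * inner (robQ (\<pi> k) s) (\<pi> (Suc k) $ s - \<nu> $ s))"
    unfolding sum.distrib[symmetric] distrib_left[symmetric] inner_add_right[symmetric] by simp
  finally have "\<eta> k * (m * (?f (\<pi> (Suc k)) - ?f (\<pi> k)) + (1 - \<gamma>) * (?f (\<pi> k) - ?f \<nu>))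
      + (\<Sum>s\<in>UNIV. ?d s * ?D (Suc k) s)
      \<le> \<eta> k * (\<Sum>s\<in>UNIV. ?d s * inner (robQ (\<pi> k) s) (\<pi> (Suc k) $ s - \<nu> $ s))
        + (\<Sum>s\<in>UNIV. ?d s * ?D (Suc k) s)"
    using \<eta> by (simp add: mult_left_mono)
  also have "\<dots> = (\<Sum>s\<in>UNIV. ?d s * (\<eta> k * inner (robQ (\<pi> k) s) (\<pi> (Suc k) $ s - \<nu> $ s) + ?D (Suc k) s))"
    by (simp only: sum_distrib_left distrib_left sum.distrib mult.left_commute)
  also have "\<dots> \<le> (\<Sum>s\<in>UNIV. ?d s * ?D k s)"
    using \<nu> d by (intro sum_mono mult_left_mono three) (auto simp: policies_def)
  finally show ?thesis
    using u by blast
qed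

lemma rpmd_convergence:
  fixes m m' Dw :: real
  assumes rpmd: "rpmd c \<gamma> PN U w \<eta> g \<pi>" and \<eta>: "\<And>k. 0 < \<eta> k" and \<nu>: "\<nu> \<in> policies"
    and \<rho>: "\<rho> \<in> prob_simplex"
    and m: "\<And>u s. u \<in> U \<Longrightarrow> visitation_avg \<gamma> (PN + u) \<nu> \<rho> s \<le> m * \<rho> $ s"
    and m': "\<And>u u' s. u \<in> U \<Longrightarrow> u' \<in> U \<Longrightarrow>
      visitation_avg \<gamma> (PN + u) \<nu> \<rho> s \<le> m' * visitation_avg \<gamma> (PN + u') \<nu> \<rho> s"
    and Dw: "\<And>s. bregman w (g 0 $ s) (\<nu> $ s) (\<pi> 0 $ s) \<le> Dw"
    and growth: "\<And>k. \<eta> k * inverse (1 - (1 - \<gamma>) / m) * m' \<le> \<eta> (Suc k)"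
  shows "objective c \<gamma> PN U \<rho> (\<pi> k) - objective c \<gamma> PN U \<rho> \<nu>
    \<le> (1 - (1 - \<gamma>) / m) ^ k * (objective c \<gamma> PN U \<rho> (\<pi> 0) - objective c \<gamma> PN U \<rho> \<nu>)
      + (1 - (1 - \<gamma>) / m) powi (int k - 1) * (Dw / (m * \<eta> 0))"
proof -
  define \<alpha> where "\<alpha> = 1 - (1 - \<gamma>) / m"
  define \<delta> where "\<delta> k = objective c \<gamma> PN U \<rho> (\<pi> k) - objective c \<gamma> PN U \<rho> \<nu>" for k
  define D where "D k s = bregman w (g k $ s) (\<nu> $ s) (\<pi> k $ s)" for k s
  define d where "d u = visitation_avg \<gamma> (PN + u) \<nu> \<rho>" for u
  have d0: "0 \<le> d u s" and d1: "(\<Sum>s\<in>UNIV. d u s) = 1" if "u \<in> U" for u s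
    using visitation_avg_nonneg[OF that \<nu> \<rho>] sum_visitation_avg[OF that \<nu> \<rho>] by (simp_all add: d_def)
  have D0: "0 \<le> D k s" for k s
    using rpmd unfolding D_def rpmd_def by (intro bregman_nonneg) blast
  obtain u0 where u0: "u0 \<in> U"
    using U_nonempty by blast
  \<comment> \<open>Summing the domination over all states compares total masses 1 and gives
    \<open>1 \<le> m\<close>; the same argument gives \<open>1 \<le> m'\<close>.\<close>
  have "(\<Sum>s\<in>UNIV. d u0 s) \<le> (\<Sum>s\<in>UNIV. m * \<rho> $ s)"
    using m[OF u0] by (intro sum_mono) (simp add: d_def)
  then have m1: "1 \<le> m"
    using \<rho> by (simp add: d1[OF u0] sum_distrib_left[symmetric] prob_simplex_def)
  have "(\<Sum>s\<in>UNIV. d u0 s) \<le> (\<Sum>s\<in>UNIV. m' * d u0 s)"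
    using m'[OF u0 u0] by (intro sum_mono) (simp add: d_def)
  then have m'1: "1 \<le> m'"
    by (simp add: d1[OF u0] sum_distrib_left[symmetric])
  \<comment> \<open>Thus \<open>\<alpha>\<close> is at least \<open>\<gamma>\<close>, hence
    positive.\<close>
  have "(1 - \<gamma>) / m \<le> 1 - \<gamma>"
    using m1 discount by (simp add: divide_le_eq mult_left_le mult_le_cancel_left1)
  then have \<alpha>: "0 < \<alpha>"
    using discount unfolding \<alpha>_def by linarith
  have Dw0: "0 \<le> Dw"
    using order_trans[OF D0[of 0] Dw[folded D_def]] .
  have "\<exists>u. u \<in> U \<and> \<eta> k * (m * (\<delta> (Suc k) - \<delta> k) + (1 - \<gamma>) * \<delta> k)
      + (\<Sum>s\<in>UNIV. d u s * D (Suc k) s) \<le> (\<Sum>s\<in>UNIV. d u s * D k s)" for k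
    using rpmd_step[OF rpmd \<eta>[of k] \<nu> \<rho> m] by (simp add: \<delta>_def D_def d_def Bex_def)
  then obtain u where u: "\<And>k. u k \<in> U" and step: "\<And>k. \<eta> k * (m * (\<delta> (Suc k) - \<delta> k) + (1 - \<gamma>) * \<delta> k)
      + (\<Sum>s\<in>UNIV. d (u k) s * D (Suc k) s) \<le> (\<Sum>s\<in>UNIV. d (u k) s * D k s)"
    by metis
  let ?X = "\<lambda>k. \<Sum>s\<in>UNIV. d (u k) s * D k s"
  have X0: "0 \<le> ?X k" for k
    by (intro sum_nonneg mult_nonneg_nonneg d0 u D0)
  \<comment> \<open>The kernel changes from \<open>u k\<close> to \<open>u (Suc k)\<close>; the
    bound \<open>m'\<close> holds for any two members of \<open>U\<close>.\<close>
  have XY: "?X (Suc k) \<le> m' * (\<Sum>s\<in>UNIV. d (u k) s * D (Suc k) s)" for k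
    unfolding sum_distrib_left mult.assoc[symmetric]
    using m'[OF u u] by (intro sum_mono mult_right_mono D0) (simp add: d_def)
  have XDw: "?X 0 \<le> Dw"
  proof -
    have "?X 0 \<le> (\<Sum>s\<in>UNIV. d (u 0) s * Dw)"
      using Dw by (intro sum_mono mult_left_mono d0 u) (simp add: D_def)
    then show ?thesis
      by (simp add: sum_distrib_right[symmetric] d1[OF u])
  qed
  have "\<delta> k \<le> \<alpha> ^ k * \<delta> 0 + \<alpha> powi (int k - 1) * (Dw / (m * \<eta> 0))"
  proof (cases k)
    \<comment> \<open>The exponent is \<open>-1\<close> here; the divergence term is nonnegative, so
      the claim is immediate.\<close>
    case 0
    have "0 \<le> inverse \<alpha> * (Dw / (m * \<eta> 0))"
      using \<alpha> Dw0 m1 \<eta>[of 0] by simp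
    then show ?thesis
      by (simp add: 0 power_int_minus)
  next
    case (Suc j)
    have "\<delta> (Suc j) + ?X (Suc j) / (m * \<eta> j * m') \<le> \<alpha> ^ j * (\<alpha> * \<delta> 0 + ?X 0 / (m * \<eta> 0))"
      using m1 m'1
      by (intro mirror_descent_recursion[where X="?X" and Y="\<lambda>k. \<Sum>s\<in>UNIV. d (u k) s * D (Suc k) s",
            OF _ _ \<alpha> \<alpha>_def \<eta> step X0 XY growth[folded \<alpha>_def]]) simp_all
    moreover have "0 \<le> ?X (Suc j) / (m * \<eta> j * m')"
      using X0[of "Suc j"] m1 m'1 \<eta>[of j] by (intro divide_nonneg_nonneg mult_nonneg_nonneg) simp_all
    ultimately have "\<delta> (Suc j) \<le> \<alpha> ^ j * (\<alpha> * \<delta> 0 + ?X 0 / (m * \<eta> 0))"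
      by linarith
    also have "\<dots> \<le> \<alpha> ^ j * (\<alpha> * \<delta> 0 + Dw / (m * \<eta> 0))"
      using \<alpha> XDw m1 \<eta>[of 0] by (intro mult_left_mono add_left_mono divide_right_mono) simp_all
    finally show ?thesis
      by (simp add: Suc algebra_simps)
  qed
  then show ?thesis
    by (simp only: \<alpha>_def \<delta>_def)
qed

end


theorem theorem3p1:
  fixes c :: "'s::finite \<Rightarrow> 'a::finite \<Rightarrow> real"
    and \<gamma> :: real
    and PN :: "real ^ 's ^ 'a ^ 's"
    and U :: "(real ^ 's ^ 'a ^ 's) set"
    and \<rho> :: "real ^ 's"
    and \<pi>opt :: "real ^ 'a ^ 's"
    and M M' :: ennreal
  assumes "robust_mdp c \<gamma> PN U"
    and "\<rho> \<in> prob_simplex"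
    and "optimal_robust c \<gamma> PN U \<pi>opt"
    and "M = (SUP u\<in>U. ratio_norm (visitation_avg \<gamma> (PN + u) \<pi>opt \<rho>) (($) \<rho>))"
    and "M' = (SUP u\<in>U. SUP u'\<in>U. ratio_norm (visitation_avg \<gamma> (PN + u) \<pi>opt \<rho>)
                                               (visitation_avg \<gamma> (PN + u') \<pi>opt \<rho>))"
  shows "((\<forall>s. 0 < \<rho> $ s) \<longrightarrow> M < \<infinity> \<and> M' < \<infinity>) \<and>
    (M < \<infinity> \<longrightarrow> M' < \<infinity> \<longrightarrow>
     (\<forall>(w :: real ^ 'a \<Rightarrow> real) \<eta> g \<pi> Dw.
        strictly_convex w \<longrightarrow>
        rpmd c \<gamma> PN U w \<eta> g \<pi> \<longrightarrow>
        bdd_above (initial_divergences w (g 0) (\<pi> 0)) \<longrightarrow>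
        Dw = Sup (initial_divergences w (g 0) (\<pi> 0)) \<longrightarrow>
        (\<forall>k. 0 < \<eta> k) \<longrightarrow>
        (\<forall>k\<ge>1. \<eta> k \<ge> \<eta> (k - 1) * inverse (1 - (1 - \<gamma>) / enn2real M) * enn2real M') \<longrightarrow>
        (\<forall>k. objective c \<gamma> PN U \<rho> (\<pi> k) - objective c \<gamma> PN U \<rho> \<pi>opt
           \<le> (1 - (1 - \<gamma>) / enn2real M) ^ k
                * (objective c \<gamma> PN U \<rho> (\<pi> 0) - objective c \<gamma> PN U \<rho> \<pi>opt)
             + (1 - (1 - \<gamma>) / enn2real M) powi (int k - 1) * (Dw / (enn2real M * \<eta> 0)))))"
proof -
  interpret robust_mdp c \<gamma> PN U
    by fact
  note \<rho> = assms(2)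
  have opt: "\<pi>opt \<in> policies"
    using assms(3) by (simp add: optimal_robust_def)
  let ?d = "\<lambda>u. visitation_avg \<gamma> (PN + u) \<pi>opt \<rho>"
  note d0 = visitation_avg_nonneg[OF _ opt \<rho>]
  show ?thesis
  proof (intro conjI impI allI)
    assume "\<forall>s. 0 < \<rho> $ s"
    then show "M < \<infinity>" "M' < \<infinity>"
      using mismatch_finite[OF \<rho> _ opt] by (simp_all add: assms(4,5))
  next
    fix w :: "real ^ 'a \<Rightarrow> real" and \<eta> g \<pi> Dw k
    assume M: "M < \<infinity>" and M': "M' < \<infinity>" and rpmd: "rpmd c \<gamma> PN U w \<eta> g \<pi>"
      and bdd: "bdd_above (initial_divergences w (g 0) (\<pi> 0))"
      and Dw: "Dw = Sup (initial_divergences w (g 0) (\<pi> 0))" and \<eta>: "\<forall>k. 0 < \<eta> k"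
      and growth: "\<forall>k\<ge>1. \<eta> k \<ge> \<eta> (k - 1) * inverse (1 - (1 - \<gamma>) / enn2real M) * enn2real M'"
    show "objective c \<gamma> PN U \<rho> (\<pi> k) - objective c \<gamma> PN U \<rho> \<pi>opt
           \<le> (1 - (1 - \<gamma>) / enn2real M) ^ k
                * (objective c \<gamma> PN U \<rho> (\<pi> 0) - objective c \<gamma> PN U \<rho> \<pi>opt)
             + (1 - (1 - \<gamma>) / enn2real M) powi (int k - 1) * (Dw / (enn2real M * \<eta> 0))"
    \<comment> \<open>As \<open>M\<close> and \<open>M'\<close> are finite, their real values bound
      the ratios entrywise, which is the form of the hypotheses on \<open>m\<close> and
      \<open>m'\<close>.\<close>
    proof (rule rpmd_convergence[OF rpmd _ opt \<rho>])
      show "0 < \<eta> k" for k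
        using \<eta> by simp
      show "?d u s \<le> enn2real M * \<rho> $ s" if "u \<in> U" for u s
      proof (rule ratio_norm_bound[OF _ M])
        show "ratio_norm (?d u) (($) \<rho>) \<le> M"
          unfolding assms(4) using that by (rule SUP_upper)
      qed (use that d0 \<rho> in \<open>auto simp: prob_simplex_def\<close>)
      show "?d u s \<le> enn2real M' * ?d u' s" if "u \<in> U" "u' \<in> U" for u u' s
      proof (rule ratio_norm_bound[OF _ M'])
        show "ratio_norm (?d u) (?d u') \<le> M'"
          unfolding assms(5) using that by (intro SUP_upper2[of u] SUP_upper2[of u']) simp_all
      qed (use that d0 in auto)
      show "bregman w (g 0 $ s) (\<pi>opt $ s) (\<pi> 0 $ s) \<le> Dw" for s
        unfolding Dw using bdd opt by (intro cSup_upper) (auto simp: initial_divergences_def)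
      show "\<eta> k * inverse (1 - (1 - \<gamma>) / enn2real M) * enn2real M' \<le> \<eta> (Suc k)" for k
        using growth[rule_format, of "Suc k"] by simp
    qed
  qed
qed

end
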